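(* Let $d,n\ge 2$, let $\mathcal D$ be a domain in $Q_0(d,n)$ whose closure $\overline{\mathcal D}$ is a compact subset of $Q_0(d,n)$, and let $\mathfrak P$ be a reduction of $\mathcal V(d,n)$ to a principal $K$-bundle over $\overline{\mathcal D}$. Then $\mathbb S(\mathcal D,\mathfrak P;d,n)$ is a proper subalgebra of $\Gamma_c(\partial\mathcal D,\mathfrak M^*(\mathfrak P;d,n))$.
   Context: Setting. A domain is a nonempty connected open set. $G=PGL(n,\mathbb C)$, $K=PU(n,\mathbb C)$, acting on $M_n(\mathbb C)$ by $s\cdot A=sAs^{-1}$ and on $M_n(\mathbb C)^d$ on the right by $\mathfrak z\cdot s=s^{-1}\mathfrak z s=(s^{-1}Z_1s,\dots,s^{-1}Z_ds)$. $\mathcal V(d,n)$ is the set of $\mathfrak z=(Z_1,\dots,Z_d)\in M_n(\mathbb C)^d$ such that $Z_1,\dots,Z_d$ generate the algebra $M_n(\mathbb C)$. $\mathbb I_0(d,n)$ is the algebra of $G$-invariant polynomial functions $M_n(\mathbb C)^d\to\mathbb C$; $p\in\mathbb I_0(d,n)$ is also identified with the matrix-valued function $\mathfrak z\mapsto p(\mathfrak z)I_n$. $\mathbb G_0(d,n)$ is the algebra of functions $M_n(\mathbb C)^d\to M_n(\mathbb C)$ generated by the coordinate functions $\mathcal Z_i(\mathfrak z)=Z_i$, and $\mathbb S_0(d,n)$ (the trace algebra) is the algebra generated by $\mathbb G_0(d,n)$ and $\mathbb I_0(d,n)$; its elements $\phi$ satisfy $\phi(s^{-1}\mathfrak z s)=s^{-1}\phi(\mathfrak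 z)s$. $Q(d,n)$ is the spectrum of the finitely generated algebra $\mathbb I_0(d,n)$, with its analytic topology, $\pi_0:M_n(\mathbb C)^d\to Q(d,n)$ is the surjection dual to the inclusion of $\mathbb I_0(d,n)$ in the polynomial functions, and $Q_0(d,n)=\pi_0(\mathcal V(d,n))$. By a theorem of Procesi (may be assumed), $Q_0(d,n)$ is an open subset of the smooth points of $Q(d,n)$ and $\pi_0:\mathcal V(d,n)\to Q_0(d,n)$ is a holomorphic principal $G$-bundle; write $[\mathfrak z]=\pi_0(\mathfrak z)$. Elements of $\mathbb I_0(d,n)$ are regarded as regular functions on $Q(d,n)$. Function algebra. $\mathbb I(\mathcal D;d,n)$ is the sup-norm closure of (the restrictions to $\overline{\mathcal D}$ of) $\mathbb I_0(d,n)$ in $C(\overline{\mathcal D})$; it is a function algebra on $\overline{\mathcal D}$, and $\partial\mathcal D\subseteq\overline{\mathcal D}$ is its Shilov boundary. Reductions and bundles. A reduction $\mathfrak P$ of $\mathcal V(d,n)$ to a principal $K$-bundle over $\overline{\mathcal D}$ is the principal $K$-bundle given by a compact $K$-invariant subset $\mathcal P\subseteq\mathcal V(d,n)$ which $\pi_0$ maps onto $\overline{\mathcal D}$ and for which $\pi_0$ identifies $\mathcal P/K$ with $\overline{\mathcal D}$. $\mathfrak M^*(\mathfrak P;d,n)$ is the associated $M_n(\mathbb C)$-bundle, with total space $\mathcal P\times_K M_n(\mathbb C)$ (quotient of $\mathcal P\times M_n(\mathbb C)$ by $(\mathfrak z,A)\cdot k=(k^{-1}\mathfrak z k,k^{-1}Ak)$)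 and projection $\pi([\mathfrak z,A])=[\mathfrak z]$; each fibre $\pi^{-1}(\mathfrak u)$ is a $C^*$-algebra isomorphic to $M_n(\mathbb C)$ via $A\mapsto[\mathfrak z,A]$ for any $\mathfrak z\in\mathcal P$ with $\pi_0(\mathfrak z)=\mathfrak u$. $\Gamma_c(\partial\mathcal D,\mathfrak M^*(\mathfrak P;d,n))$ is the $C^*$-algebra of continuous cross sections over $\partial\mathcal D$, with fibrewise operations and the supremum norm. For $\phi\in\mathbb S_0(d,n)$, $\Psi(\phi)$ is the section $\Psi(\phi)([\mathfrak z])=[\mathfrak z,\phi(\mathfrak z)]$, $\mathfrak z\in\mathcal P$. $\mathbb S(\mathcal D,\mathfrak P;d,n)$ (the tracial function algebra) is the norm closure of $\Psi(\mathbb S_0(d,n))$ in $\Gamma_c(\partial\mathcal D,\mathfrak M^*(\mathfrak P;d,n))$. *)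

theory Defs
  imports "HOL-Analysis.Analysis"
begin

definition unital_subalgebra ::
  "'a \<Rightarrow> ('a \<Rightarrow> 'a \<Rightarrow> 'a) \<Rightarrow> (complex \<Rightarrow> 'a \<Rightarrow> 'a) \<Rightarrow> ('a \<Rightarrow> 'a \<Rightarrow> 'a) \<Rightarrow> 'a set \<Rightarrow> bool"
  where "unital_subalgebra one add smul mul B \<longleftrightarrow>
    one \<in> B \<and>
    (\<forall>a\<in>B. \<forall>b\<in>B. add a b \<in> B \<and> mul a b \<in> B) \<and>
    (\<forall>c. \<forall>a\<in>B. smul c a \<in> B)"

type_synonym 'n cmat = "complex ^ 'n ^ 'n"
type_synonym ('d, 'n) tuple = "complex ^ 'n ^ 'n ^ 'd"

definition mat_scale :: "complex \<Rightarrow> 'n::finite cmat \<Rightarrow> 'n cmat"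
  where "mat_scale c A = map_matrix (\<lambda>x. c * x) A"

definition scalar_fun_subalgebra :: "('x \<Rightarrow> complex) set \<Rightarrow> bool"
  where "scalar_fun_subalgebra =
    unital_subalgebra (\<lambda>x. 1) (\<lambda>f g x. f x + g x) (\<lambda>c f x. c * f x) (\<lambda>f g x. f x * g x)"

definition mat_subalgebra :: "'n::finite cmat set \<Rightarrow> bool"
  where "mat_subalgebra = unital_subalgebra (mat 1) (+) mat_scale (**)"

definition mat_fun_subalgebra :: "('x \<Rightarrow> 'n::finite cmat) set \<Rightarrow> bool"
  where "mat_fun_subalgebra =
    unital_subalgebra (\<lambda>x. mat 1) (\<lambda>f g x. f x + g x)
      (\<lambda>c f x. mat_scale c (f x)) (\<lambda>f g x. f x ** g x)"

text \<open>The groups \<open>PGL(n)\<close> and \<open>PU(n)\<close> act by conjugation. The actions are written through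
  representatives in \<open>GL(n)\<close> and \<open>U(n)\<close>, on which scalars act trivially.\<close>

definition mat_conj :: "'n::finite cmat \<Rightarrow> 'n cmat \<Rightarrow> 'n cmat"
  where "mat_conj s A = matrix_inv s ** A ** s"

definition tuple_conj :: "'n::finite cmat \<Rightarrow> ('d::finite, 'n) tuple \<Rightarrow> ('d, 'n) tuple"
  where "tuple_conj s z = (\<chi> i. mat_conj s (z $ i))"

definition unitary :: "'n::finite cmat \<Rightarrow> bool"
  where "unitary k \<longleftrightarrow>
    k ** map_matrix cnj (transpose k) = mat 1 \<and> map_matrix cnj (transpose k) ** k = mat 1"

definition generating_tuples :: "('d::finite, 'n::finite) tuple set"
  where "generating_tuples = {z. mat_subalgebra hull (range (\<lambda>i. z $ i)) = UNIV}"

definition polynomial_functions :: "(('d::finite, 'n::finite) tuple \<Rightarrow> complex) set"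
  where "polynomial_functions =
    scalar_fun_subalgebra hull {f. \<exists>i j k. f = (\<lambda>z. z $ i $ j $ k)}"

definition invariants :: "(('d::finite, 'n::finite) tuple \<Rightarrow> complex) set"
  where "invariants =
    {p \<in> polynomial_functions. \<forall>s z. invertible s \<longrightarrow> p (tuple_conj s z) = p z}"

definition generic_matrix_algebra :: "(('d::finite, 'n::finite) tuple \<Rightarrow> 'n cmat) set"
  where "generic_matrix_algebra = mat_fun_subalgebra hull (range (\<lambda>i z. z $ i))"

definition trace_algebra :: "(('d::finite, 'n::finite) tuple \<Rightarrow> 'n cmat) set"
  where "trace_algebra =
    mat_fun_subalgebra hull (generic_matrix_algebra \<union> {\<lambda>z. mat (p z) | p. p \<in> invariants})"

text \<open>Points of the spectrum are complex algebra characters of the ring of invariants, which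
  by the Nullstellensatz are the same as its maximal ideals. Characters are taken to be
  extensional on the ring of invariants.\<close>

type_synonym ('d, 'n) qpoint = "(('d, 'n) tuple \<Rightarrow> complex) \<Rightarrow> complex"

definition Q_space :: "('d::finite, 'n::finite) qpoint set"
  where "Q_space = {\<xi> \<in> extensional invariants.
    \<xi> (\<lambda>z. 1) = 1 \<and>
    (\<forall>p\<in>invariants. \<forall>q\<in>invariants.
       \<xi> (\<lambda>z. p z + q z) = \<xi> p + \<xi> q \<and> \<xi> (\<lambda>z. p z * q z) = \<xi> p * \<xi> q) \<and>
    (\<forall>c. \<forall>p\<in>invariants. \<xi> (\<lambda>z. c * p z) = c * \<xi> p)}"

text \<open>The analytic topology of a complex affine variety is the one induced from complex affine
  space by the values of finitely many generators of the coordinate ring. As every other regular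
  function is a polynomial in these, it is the topology of pointwise convergence of characters.\<close>

definition Q_top :: "('d::finite, 'n::finite) qpoint topology"
  where "Q_top = subtopology (product_topology (\<lambda>_. euclidean) invariants) Q_space"

definition pi0 :: "('d::finite, 'n::finite) tuple \<Rightarrow> ('d, 'n) qpoint"
  where "pi0 z = (\<lambda>p\<in>invariants. p z)"

definition Q0_space :: "('d::finite, 'n::finite) qpoint set"
  where "Q0_space = pi0 ` generating_tuples"

definition Q0_domain :: "('d::finite, 'n::finite) qpoint set \<Rightarrow> bool"
  where "Q0_domain D \<longleftrightarrow>
    D \<noteq> {} \<and> openin (subtopology Q_top Q0_space) D \<and> connectedin Q_top D"

definition sup_norm :: "('b \<Rightarrow> real) \<Rightarrow> 'a set \<Rightarrow> ('a \<Rightarrow> 'b) \<Rightarrow> real"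
  where "sup_norm N X f = (SUP x\<in>X. N (f x))"

text \<open>An invariant \<open>p\<close>, viewed as a regular function on the spectrum, is evaluation of
  characters at \<open>p\<close>.\<close>

definition invariant_function_algebra ::
  "('d::finite, 'n::finite) qpoint set \<Rightarrow> (('d, 'n) qpoint \<Rightarrow> complex) set"
  where "invariant_function_algebra D = (let X = Q_top closure_of D in
    {f \<in> extensional X. continuous_map (subtopology Q_top X) euclidean f \<and>
       (\<forall>e>0. \<exists>p\<in>invariants. sup_norm norm X (\<lambda>\<xi>. f \<xi> - \<xi> p) < e)})"

definition closed_boundary :: "'a topology \<Rightarrow> ('a \<Rightarrow> complex) set \<Rightarrow> 'a set \<Rightarrow> bool"
  where "closed_boundary T A B \<longleftrightarrow>
    closedin T B \<and> (\<forall>f\<in>A. \<exists>x\<in>B. \<forall>y\<in>topspace T. norm (f y) \<le> norm (f x))"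

definition shilov_boundary :: "'a topology \<Rightarrow> ('a \<Rightarrow> complex) set \<Rightarrow> 'a set"
  where "shilov_boundary T A = topspace T \<inter> \<Inter>{B. closed_boundary T A B}"

definition bdry :: "('d::finite, 'n::finite) qpoint set \<Rightarrow> ('d, 'n) qpoint set"
  where "bdry D =
    shilov_boundary (subtopology Q_top (Q_top closure_of D)) (invariant_function_algebra D)"

text \<open>The last two clauses say that \<open>pi0\<close> induces a homeomorphism from \<open>P/K\<close> onto the closure
  of \<open>D\<close>. Stabilisers in \<open>PU(n)\<close> of generating tuples are trivial, so \<open>P\<close> is then a principal
  \<open>PU(n)\<close>-bundle.\<close>

definition reduction ::
  "('d::finite, 'n::finite) qpoint set \<Rightarrow> ('d, 'n) tuple set \<Rightarrow> bool"
  where "reduction D P \<longleftrightarrow>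
    compact P \<and> P \<subseteq> generating_tuples \<and>
    (\<forall>k. unitary k \<longrightarrow> (\<forall>z\<in>P. tuple_conj k z \<in> P)) \<and>
    quotient_map (top_of_set P) (subtopology Q_top (Q_top closure_of D)) pi0 \<and>
    (\<forall>z\<in>P. \<forall>w\<in>P. pi0 z = pi0 w \<longrightarrow> (\<exists>k. unitary k \<and> w = tuple_conj k z))"

definition quotient_topology :: "'a topology \<Rightarrow> ('a \<Rightarrow> 'b) \<Rightarrow> 'b topology"
  where "quotient_topology T q =
    topology (\<lambda>U. U \<subseteq> q ` topspace T \<and> openin T {x \<in> topspace T. q x \<in> U})"

lemma openin_quotient_topology:
  "openin (quotient_topology T q) U \<longleftrightarrow>
     U \<subseteq> q ` topspace T \<and> openin T {x \<in> topspace T. q x \<in> U}"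
proof -
  have "istopology (\<lambda>U. U \<subseteq> q ` topspace T \<and> openin T {x \<in> topspace T. q x \<in> U})"
    unfolding istopology_def
  proof (intro conjI allI impI, goal_cases)
    case (2 S U)
    have "{x \<in> topspace T. q x \<in> S \<inter> U} =
        {x \<in> topspace T. q x \<in> S} \<inter> {x \<in> topspace T. q x \<in> U}"
      by auto
    with 2 show ?case by (metis (no_types, lifting) openin_Int)
  next
    case (4 \<K>)
    have "{x \<in> topspace T. q x \<in> \<Union>\<K>} = (\<Union>U\<in>\<K>. {x \<in> topspace T. q x \<in> U})"
      by auto
    with 4 show ?case by auto
  qed auto
  then show ?thesis
    by (simp add: quotient_topology_def)
qed

lemma quotient_map_quotient_topology: "quotient_map T (quotient_topology T q) q"
proof -
  have "openin T {x \<in> topspace T. q x \<in> q ` topspace T}"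
    by (simp add: image_iff) (smt (verit) Collect_cong Collect_mem_eq openin_topspace)
  then have "topspace (quotient_topology T q) = q ` topspace T"
    by (intro subset_antisym openin_subset)
      (auto simp: openin_quotient_topology topspace_def[of "quotient_topology T q"])
  then show ?thesis
    by (auto simp: quotient_map_def openin_quotient_topology)
qed

type_synonym ('d, 'n) bundle_pt = "(('d, 'n) tuple \<times> 'n cmat) set"

definition bundle_rel ::
  "('d::finite, 'n::finite) tuple set \<Rightarrow>
    ((('d, 'n) tuple \<times> 'n cmat) \<times> (('d, 'n) tuple \<times> 'n cmat)) set"
  where "bundle_rel P =
    {((z, A), (tuple_conj k z, mat_conj k A)) | z A k. z \<in> P \<and> unitary k}"

definition bundle_class ::
  "('d::finite, 'n::finite) tuple set \<Rightarrow> ('d, 'n) tuple \<Rightarrow> 'n cmat \<Rightarrow> ('d, 'n) bundle_pt"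
  where "bundle_class P z A = bundle_rel P `` {(z, A)}"

definition bundle_top :: "('d::finite, 'n::finite) tuple set \<Rightarrow> ('d, 'n) bundle_pt topology"
  where "bundle_top P =
    quotient_topology (top_of_set (P \<times> UNIV)) (\<lambda>(z, A). bundle_class P z A)"

definition bundle_proj :: "('d::finite, 'n::finite) bundle_pt \<Rightarrow> ('d, 'n) qpoint"
  where "bundle_proj e = (THE u. \<exists>z A. (z, A) \<in> e \<and> u = pi0 z)"

text \<open>The operations on a fibre are those transported from matrices along
  \<open>A \<mapsto> [z, A]\<close>. The action on generating tuples is free modulo scalars, so each \<open>z\<close> occurs
  with exactly one matrix in a class; hence adding the second components over all common first
  components turns \<open>[z, A]\<close> and \<open>[z, B]\<close> into \<open>[z, A + B]\<close>, and similarly for the other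
  operations.\<close>

definition fib_add ::
  "('d::finite, 'n::finite) bundle_pt \<Rightarrow> ('d, 'n) bundle_pt \<Rightarrow> ('d, 'n) bundle_pt"
  where "fib_add e f = {(z, A + B) | z A B. (z, A) \<in> e \<and> (z, B) \<in> f}"

definition fib_mult ::
  "('d::finite, 'n::finite) bundle_pt \<Rightarrow> ('d, 'n) bundle_pt \<Rightarrow> ('d, 'n) bundle_pt"
  where "fib_mult e f = {(z, A ** B) | z A B. (z, A) \<in> e \<and> (z, B) \<in> f}"

definition fib_scale ::
  "complex \<Rightarrow> ('d::finite, 'n::finite) bundle_pt \<Rightarrow> ('d, 'n) bundle_pt"
  where "fib_scale c e = {(z, mat_scale c A) | z A. (z, A) \<in> e}"

text \<open>The norm of a fibre is the operator norm of \<open>M\<^sub>n\<close>, which is constant on classes because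
  they are unitary orbits.\<close>

definition fib_norm :: "('d::finite, 'n::finite) bundle_pt \<Rightarrow> real"
  where "fib_norm e = (THE r. \<exists>z A. (z, A) \<in> e \<and> r = onorm (\<lambda>v. A *v v))"

type_synonym ('d, 'n) bundle_section = "('d, 'n) qpoint \<Rightarrow> ('d, 'n) bundle_pt"

definition sec_add ::
  "('d::finite, 'n::finite) qpoint set \<Rightarrow>
    ('d, 'n) bundle_section \<Rightarrow> ('d, 'n) bundle_section \<Rightarrow> ('d, 'n) bundle_section"
  where "sec_add X \<sigma> \<tau> = (\<lambda>u\<in>X. fib_add (\<sigma> u) (\<tau> u))"

definition sec_mult ::
  "('d::finite, 'n::finite) qpoint set \<Rightarrow>
    ('d, 'n) bundle_section \<Rightarrow> ('d, 'n) bundle_section \<Rightarrow> ('d, 'n) bundle_section"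
  where "sec_mult X \<sigma> \<tau> = (\<lambda>u\<in>X. fib_mult (\<sigma> u) (\<tau> u))"

definition sec_scale ::
  "('d::finite, 'n::finite) qpoint set \<Rightarrow>
    complex \<Rightarrow> ('d, 'n) bundle_section \<Rightarrow> ('d, 'n) bundle_section"
  where "sec_scale X c \<sigma> = (\<lambda>u\<in>X. fib_scale c (\<sigma> u))"

definition Gamma_c ::
  "('d::finite, 'n::finite) qpoint set \<Rightarrow> ('d, 'n) tuple set \<Rightarrow> ('d, 'n) bundle_section set"
  where "Gamma_c X P =
    {\<sigma> \<in> extensional X. continuous_map (subtopology Q_top X) (bundle_top P) \<sigma> \<and>
       (\<forall>u\<in>X. bundle_proj (\<sigma> u) = u)}"

text \<open>The class \<open>[z, \<phi> z]\<close> depends only on \<open>[z]\<close> when \<open>\<phi>\<close> commutes with conjugation.\<close>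

definition Psi ::
  "('d::finite, 'n::finite) qpoint set \<Rightarrow> ('d, 'n) tuple set \<Rightarrow>
    (('d, 'n) tuple \<Rightarrow> 'n cmat) \<Rightarrow> ('d, 'n) bundle_section"
  where "Psi X P \<phi> = (\<lambda>u\<in>X. THE e. \<exists>z\<in>P. pi0 z = u \<and> e = bundle_class P z (\<phi> z))"

definition tracial_function_algebra ::
  "('d::finite, 'n::finite) qpoint set \<Rightarrow> ('d, 'n) tuple set \<Rightarrow> ('d, 'n) bundle_section set"
  where "tracial_function_algebra D P = {\<sigma> \<in> Gamma_c (bdry D) P.
    \<forall>e>0. \<exists>\<phi>\<in>trace_algebra. sup_norm fib_norm (bdry D)
      (sec_add (bdry D) \<sigma> (sec_scale (bdry D) (-1) (Psi (bdry D) P \<phi>))) < e}"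

definition section_subalgebra ::
  "('d::finite, 'n::finite) qpoint set \<Rightarrow> ('d, 'n) tuple set \<Rightarrow>
    ('d, 'n) bundle_section set \<Rightarrow> bool"
  where "section_subalgebra X P B \<longleftrightarrow> B \<subseteq> Gamma_c X P \<and>
    unital_subalgebra (Psi X P (\<lambda>z. mat 1)) (sec_add X) (sec_scale X) (sec_mult X) B"

end

theory Submission
  imports Defs "HOL-Complex_Analysis.Conformal_Mappings"
begin

text \<open>
  By the correspondence between continuous sections of the associated matrix bundle and continuous
  equivariant matrix functions on the reduction (lemmas \<open>Psi_in_Gamma_c\<close> and \<open>Gamma_c_imp_Psi\<close>), the
  tracial function algebra consists of the functions that are uniform limits of the trace algebra
  over the Shilov boundary. That these form an algebra is the usual estimate for sums and products.

  For properness, suppose that every continuous section is such a limit, and let \<open>p\<close> be the trace of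
  one of the coordinate matrices. The scalar section \<open>cnj p\<close> is then a limit, and taking traces shows
  that \<open>cnj p\<close> is a uniform limit of invariants on the Shilov boundary. Invariants attain their maximum
  modulus on the Shilov boundary (lemma \<open>invariant_attains_max_on_bdry\<close>, which rests on the existence of
  Shilov boundaries), and this maximum principle carries over to imaginary parts. Since the real and
  imaginary parts of \<open>q - cnj p\<close> are imaginary parts of invariants, the approximation of \<open>cnj p\<close> extends to
  the whole closure of the domain (lemma \<open>approximate_cnj_extends\<close>). A generating tuple stays generating
  when a scalar \<open>\<zeta>\<close> is added to all its matrices, so the domain contains a disc along which invariants
  are holomorphic in \<open>\<zeta>\<close> and \<open>p\<close> equals \<open>n \<zeta>\<close> up to a constant. There \<open>cnj \<zeta>\<close> would be a uniform limit of
  holomorphic functions, which the maximum modulus principle forbids.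
\<close>

section \<open>Existence of the Shilov boundary\<close>

lemma closed_boundary_attains:
  assumes "closed_boundary T A B" "f \<in> A"
  obtains x where "x \<in> B" "x \<in> topspace T" "\<And>y. y \<in> topspace T \<Longrightarrow> norm (f y) \<le> norm (f x)"
  using assms unfolding closed_boundary_def by (metis closedin_subset subsetD)

lemma mult_closed_power:
  assumes mult: "\<And>f g. f \<in> A \<Longrightarrow> g \<in> A \<Longrightarrow> \<exists>h\<in>A. \<forall>x\<in>X. h x = (f x * g x :: complex)"
    and "f \<in> A" "g \<in> A"
  shows "\<exists>h\<in>A. \<forall>x\<in>X. h x = f x ^ Suc m * g x"
proof (induction m)
  case 0
  then show ?case using mult[OF assms(2,3)] by simp
next
  case (Suc m)
  then obtain h where "h \<in> A" "\<forall>x\<in>X. h x = f x ^ Suc m * g x" by blast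
  then show ?case using mult[OF assms(2), of h] by (auto simp: mult.assoc)
qed

text \<open>If a polyhedron \<open>V\<close> of functions in \<open>A\<close> misses one closed boundary \<open>G\<close>, it can be removed from every
  closed boundary \<open>E\<close>. Otherwise some \<open>g\<close> in \<open>A\<close> has modulus
  strictly below its maximum on \<open>E - V\<close>; for each \<open>f\<close> defining \<open>V\<close>, the function \<open>g ^ m * f\<close> with \<open>m\<close>
  large then stays below the \<open>m\<close>-th power of this maximum on all of \<open>E\<close> (if \<open>E - V\<close> is empty, already
  \<open>norm f < 1\<close> on \<open>E\<close>). Hence \<open>norm f < 1\<close> wherever
  \<open>norm g\<close> is maximal, so that such points lie in \<open>V\<close>, although \<open>G\<close> contains one of them.\<close>

lemma closed_boundary_Diff_polyhedron:
  fixes A :: "('a \<Rightarrow> complex) set"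
  assumes "compact_space T"
    and cont: "\<And>f. f \<in> A \<Longrightarrow> continuous_map T euclidean f"
    and mult: "\<And>f g. f \<in> A \<Longrightarrow> g \<in> A \<Longrightarrow> \<exists>h\<in>A. \<forall>x\<in>topspace T. h x = f x * g x"
    and F: "F \<subseteq> A"
    and V: "V = {y \<in> topspace T. \<forall>f\<in>F. norm (f y) < 1}" "openin T V"
    and G: "closed_boundary T A G" "G \<inter> V = {}"
    and E: "closed_boundary T A E"
  shows "closed_boundary T A (E - V)"
proof (rule ccontr)
  assume "\<not> ?thesis"
  moreover have cl: "closedin T (E - V)"
    using E V(2) by (auto simp: closed_boundary_def)
  ultimately obtain g where g: "g \<in> A"
    and nog: "\<And>x. x \<in> E - V \<Longrightarrow> \<exists>y\<in>topspace T. norm (g x) < norm (g y)"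
    unfolding closed_boundary_def by (metis not_le)
  obtain e where e: "e \<in> E" "e \<in> topspace T" "\<And>y. y \<in> topspace T \<Longrightarrow> norm (g y) \<le> norm (g e)"
    using closed_boundary_attains[OF E g] by blast
  obtain w where w: "w \<in> G" "w \<in> topspace T" "\<And>y. y \<in> topspace T \<Longrightarrow> norm (g y) \<le> norm (g w)"
    using closed_boundary_attains[OF G(1) g] by blast
  define M where "M = norm (g e)"
  have M: "norm (g w) = M" using e w unfolding M_def by (meson antisym)
  have less: "norm (g x) < M" if "x \<in> E - V" for x
    using nog[OF that] e(3) unfolding M_def by (meson less_le_trans)
  have "norm (f w) < 1" if f: "f \<in> F" for f
  proof (cases "E - V = {}")
    case True
    obtain x where "x \<in> E" "\<And>y. y \<in> topspace T \<Longrightarrow> norm (f y) \<le> norm (f x)"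
      using closed_boundary_attains[OF E] f F by blast
    moreover have "norm (f x) < 1" using True \<open>x \<in> E\<close> f V(1) by blast
    ultimately show ?thesis using w(2) by (meson le_less_trans)
  next
    case False
    have K: "compactin T (E - V)"
      using closedin_compact_space[OF \<open>compact_space T\<close> cl] .
    have comp: "compact ((\<lambda>x. norm (k x)) ` (E - V))" if "k \<in> A" for k
      using image_compactin[OF K, of euclidean "\<lambda>x. norm (k x)"] cont[OF that]
      by (simp add: continuous_map_norm)
    obtain a where a: "a \<in> E - V" "\<And>x. x \<in> E - V \<Longrightarrow> norm (g x) \<le> norm (g a)"
      using compact_attains_sup[OF comp[OF g]] False by (auto simp: Bex_def)
    have "bounded ((\<lambda>x. norm (f x)) ` (E - V))"
      using compact_imp_bounded[OF comp] f F by blast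
    then obtain C where C: "\<And>x. x \<in> E - V \<Longrightarrow> norm (f x) \<le> C" "C > 0"
      unfolding bounded_pos by auto
    have M0: "M > 0" using less[OF a(1)] by (meson norm_ge_zero le_less_trans)
    define q where "q = norm (g a) / M"
    have q: "0 \<le> q" "q < 1" using less[OF a(1)] M0 by (auto simp: q_def)
    obtain m where "q ^ m < 1 / C" using real_arch_pow_inv[of "1/C" q] C(2) q by auto
    then have "q ^ Suc m < 1 / C"
      using q power_decreasing[of m "Suc m" q] by linarith
    then have mC: "norm (g a) ^ Suc m * C < M ^ Suc m"
      using C(2) M0 by (simp add: q_def power_divide field_simps)
    obtain h where h: "h \<in> A" "\<forall>x\<in>topspace T. h x = g x ^ Suc m * f x"
      using mult_closed_power[where X = "topspace T", OF mult g] f F by (metis (no_types) subsetD)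
    obtain b where b: "b \<in> E" "b \<in> topspace T" "\<And>y. y \<in> topspace T \<Longrightarrow> norm (h y) \<le> norm (h b)"
      using closed_boundary_attains[OF E h(1)] by blast
    have "norm (h b) < M ^ Suc m"
    proof (cases "b \<in> V")
      case True
      then have "norm (f b) < 1" using V f by blast
      have "norm (h b) = norm (g b) ^ Suc m * norm (f b)"
        using h(2) b(2) by (simp add: norm_mult norm_power)
      also have "\<dots> \<le> M ^ Suc m * norm (f b)"
        using e(3)[OF b(2)] by (intro mult_right_mono power_mono) (auto simp: M_def)
      also have "\<dots> < M ^ Suc m * 1"
        using \<open>norm (f b) < 1\<close> M0 by (intro mult_strict_left_mono) auto
      finally show ?thesis by simp
    next
      case False
      have "norm (h b) = norm (g b) ^ Suc m * norm (f b)"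
        using h(2) b(2) by (simp add: norm_mult norm_power)
      also have "\<dots> \<le> norm (g a) ^ Suc m * C"
        using a(2)[of b] C(1)[of b] False b(1) by (intro mult_mono power_mono) auto
      finally show ?thesis using mC by linarith
    qed
    then have "norm (h w) < M ^ Suc m" using b(3)[OF w(2)] by linarith
    moreover have "norm (h w) = M ^ Suc m * norm (f w)"
      using h(2) w(2) M by (simp add: norm_mult norm_power)
    ultimately show ?thesis using M0 by (smt (verit) mult_le_cancel_left1 zero_less_power)
  qed
  then have "w \<in> V" using w(2) V(1) by blast
  then show False using w(1) G(2) by blast
qed

lemma closedin_shilov_boundary: "closedin T (shilov_boundary T A)"
proof -
  have "shilov_boundary T A = \<Inter>(insert (topspace T) {B. closed_boundary T A B})"
    by (simp add: shilov_boundary_def)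
  also have "closedin T \<dots>"
    by (rule closedin_Inter) (auto simp: closed_boundary_def)
  finally show ?thesis .
qed

text \<open>Existence of the Shilov boundary: the intersection of all closed boundaries is a closed boundary.
  Linear operations are not needed, only products and the fact that polyhedra of \<open>A\<close> are a base of the
  topology. If the maximum set \<open>K\<close> of \<open>norm f\<close> missed the intersection, then finitely many polyhedra, each
  disjoint from some closed boundary, would cover \<open>K\<close>, and removing them one by one from the whole space
  would leave a closed boundary disjoint from \<open>K\<close>.\<close>

lemma closed_boundary_shilov_boundary:
  fixes A :: "('a \<Rightarrow> complex) set"
  assumes comp: "compact_space T" and ne: "topspace T \<noteq> {}"
    and cont: "\<And>f. f \<in> A \<Longrightarrow> continuous_map T euclidean f"
    and mult: "\<And>f g. f \<in> A \<Longrightarrow> g \<in> A \<Longrightarrow> \<exists>h\<in>A. \<forall>x\<in>topspace T. h x = f x * g x"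
    and base: "\<And>U x. openin T U \<Longrightarrow> x \<in> U \<Longrightarrow> \<exists>F\<subseteq>A. finite F \<and> (\<forall>f\<in>F. norm (f x) < 1) \<and>
        {y \<in> topspace T. \<forall>f\<in>F. norm (f y) < 1} \<subseteq> U"
  shows "closed_boundary T A (shilov_boundary T A)"
proof -
  have attain: "\<exists>x\<in>topspace T. \<forall>y\<in>topspace T. norm (f y) \<le> norm (f x)" if "f \<in> A" for f
  proof -
    have "compact ((\<lambda>x. norm (f x)) ` topspace T)"
      using image_compactin[of T "topspace T" euclidean "\<lambda>x. norm (f x)"] comp cont[OF that]
      by (simp add: continuous_map_norm compact_space_def)
    then show ?thesis using compact_attains_sup[of "(\<lambda>x. norm (f x)) ` topspace T"] ne by auto
  qed
  then have top: "closed_boundary T A (topspace T)" by (simp add: closed_boundary_def)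
  have openV: "openin T {y \<in> topspace T. \<forall>f\<in>F. norm (f y) < 1}" if "finite F" "F \<subseteq> A" for F
  proof -
    have "openin T {y \<in> topspace T. norm (f y) < 1}" if "f \<in> A" for f
      using openin_continuous_map_preimage[OF continuous_map_norm[OF cont[OF that]], of "{..<1}"]
      by (simp add: open_lessThan)
    then have "openin T (topspace T \<inter> (\<Inter>f\<in>F. {y \<in> topspace T. norm (f y) < 1}))" 
      using that by (cases "F = {}") (auto intro!: openin_Int openin_Inter)
    then show ?thesis by (rule back_subst[of "openin T"]) auto
  qed
  have "closedin T (shilov_boundary T A)" by (rule closedin_shilov_boundary)
  moreover have "\<exists>x\<in>shilov_boundary T A. \<forall>y\<in>topspace T. norm (f y) \<le> norm (f x)" if f: "f \<in> A" for f
  proof (rule ccontr)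
    assume no: "\<not> ?thesis"
    obtain x0 where x0: "x0 \<in> topspace T" "\<And>y. y \<in> topspace T \<Longrightarrow> norm (f y) \<le> norm (f x0)"
      using attain[OF f] by blast
    define K where "K = {x \<in> topspace T. norm (f x) = norm (f x0)}"
    have "closedin T K"
      unfolding K_def
      using closedin_continuous_map_preimage[OF continuous_map_norm[OF cont[OF f]], of "{norm (f x0)}"] by simp
    then have K: "compactin T K" using closedin_compact_space comp by blast
    define \<V> where "\<V> = {V. openin T V \<and> (\<exists>F. F \<subseteq> A \<and> V = {y \<in> topspace T. \<forall>f\<in>F. norm (f y) < 1})
       \<and> (\<exists>G. closed_boundary T A G \<and> G \<inter> V = {})}"
    have "K \<subseteq> \<Union>\<V>"
    proof
      fix x assume x: "x \<in> K"
      then have "x \<notin> shilov_boundary T A" using no x0 unfolding K_def by force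
      then obtain G where G: "closed_boundary T A G" "x \<notin> G"
        using x unfolding shilov_boundary_def K_def by blast
      then have "openin T (topspace T - G)" "x \<in> topspace T - G"
        using x by (auto simp: closed_boundary_def K_def)
      from base[OF this] obtain F where F: "F \<subseteq> A" "finite F" "\<forall>f\<in>F. norm (f x) < 1"
        "{y \<in> topspace T. \<forall>f\<in>F. norm (f y) < 1} \<subseteq> topspace T - G" by blast
      then have "{y \<in> topspace T. \<forall>f\<in>F. norm (f y) < 1} \<in> \<V>"
        using openV[OF F(2,1)] G(1) unfolding \<V>_def by blast
      then show "x \<in> \<Union>\<V>" using F(3) x unfolding K_def by blast
    qed
    then obtain \<F> where \<F>: "finite \<F>" "\<F> \<subseteq> \<V>" "K \<subseteq> \<Union>\<F>"
      using compactinD[OF K, of \<V>] unfolding \<V>_def by blast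
    from \<F>(1,2) have "closed_boundary T A (topspace T - \<Union>\<F>)"
    proof (induction \<F>)
      case empty
      then show ?case using top by simp
    next
      case (insert V \<F>)
      then have "closed_boundary T A (topspace T - \<Union>\<F>)" and "V \<in> \<V>" by auto
      moreover from \<open>V \<in> \<V>\<close> obtain F G where "F \<subseteq> A" "openin T V"
        "V = {y \<in> topspace T. \<forall>f\<in>F. norm (f y) < 1}" "closed_boundary T A G" "G \<inter> V = {}"
        unfolding \<V>_def by blast
      ultimately have "closed_boundary T A (topspace T - \<Union>\<F> - V)"
        using closed_boundary_Diff_polyhedron[OF comp cont mult] by blast
      moreover have "topspace T - \<Union>\<F> - V = topspace T - \<Union>(insert V \<F>)" by auto
      ultimately show ?case by simp
    qed
    then obtain x where x: "x \<in> topspace T - \<Union>\<F>" "\<And>y. y \<in> topspace T \<Longrightarrow> norm (f y) \<le> norm (f x)"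
      using closed_boundary_attains[OF _ f] by metis
    then have "x \<in> K" using x0 unfolding K_def by (auto intro: antisym)
    then show False using x(1) \<F>(3) by blast
  qed
  ultimately show ?thesis unfolding closed_boundary_def by blast
qed

section \<open>Conjugation, unitary matrices and the operator norm\<close>

lemma unital_subalgebra_hull:
  "unital_subalgebra one add smul mul (unital_subalgebra one add smul mul hull S)"
  by (rule hull_in) (auto simp: unital_subalgebra_def)

lemma mat_scale_eq_mat_mult: "mat_scale c A = mat c ** A"
  by (simp add: mat_scale_def matrix_matrix_mult_def mat_def vec_eq_iff if_distrib if_distribR cong: if_cong)

lemma mat_scale_nth [simp]: "mat_scale c A $ i $ j = c * A $ i $ j"
  by (simp add: mat_scale_def)

lemma mat_scale_mult_left: "mat_scale c A ** B = mat_scale c (A ** B)"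
  by (simp add: mat_scale_eq_mat_mult matrix_mul_assoc)

lemma mat_scale_mult_right: "A ** mat_scale c B = mat_scale c (A ** B)"
  by (simp add: vec_eq_iff matrix_matrix_mult_def sum_distrib_left mult_ac)

lemma matrix_inv_cancel:
  fixes s :: "'n::finite cmat"
  assumes "invertible s"
  shows "s ** matrix_inv s = mat 1" "matrix_inv s ** s = mat 1"
  using someI_ex[of "\<lambda>t. s ** t = mat 1 \<and> t ** s = mat 1"] assms
  by (auto simp: invertible_def matrix_inv_def)

lemma matrix_inv_unique:
  fixes s :: "'n::finite cmat"
  assumes "s ** t = mat 1" "t ** s = mat 1"
  shows "matrix_inv s = t"
proof -
  have "invertible s" using assms by (auto simp: invertible_def)
  then have "matrix_inv s = matrix_inv s ** (s ** t)" using assms by simp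
  also have "\<dots> = t" by (simp add: matrix_mul_assoc matrix_inv_cancel[OF \<open>invertible s\<close>])
  finally show ?thesis .
qed

lemma mat_add_mult: "(A + B) ** C = A ** C + B ** (C :: 'n::finite cmat)"
  by (simp add: vec_eq_iff matrix_matrix_mult_def sum.distrib distrib_right)

lemma mat_mult_diff:
  fixes A B C :: "'n::finite cmat"
  shows "A ** (B - C) = A ** B - A ** C" "(A - B) ** C = A ** C - B ** C"
  by (simp_all add: vec_eq_iff matrix_matrix_mult_def sum_subtractf left_diff_distrib right_diff_distrib)

lemma mat_conj_add: "mat_conj s (A + B) = mat_conj s A + mat_conj s B"
  by (simp add: mat_conj_def matrix_add_ldistrib mat_add_mult)

lemma mat_conj_scale: "mat_conj s (mat_scale c A) = mat_scale c (mat_conj s A)"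
  by (simp add: mat_conj_def mat_scale_mult_left mat_scale_mult_right)

lemma mat_conj_mult:
  assumes "invertible s"
  shows "mat_conj s (A ** B) = mat_conj s A ** mat_conj s B"
proof -
  have "mat_conj s A ** mat_conj s B = matrix_inv s ** A ** (s ** matrix_inv s) ** B ** s"
    by (simp add: mat_conj_def matrix_mul_assoc)
  then show ?thesis by (simp add: matrix_inv_cancel[OF assms] mat_conj_def matrix_mul_assoc)
qed

lemma mat_conj_mat:
  assumes "invertible s"
  shows "mat_conj s (mat c) = mat c"
proof -
  have "mat_conj s (mat_scale c (mat 1)) = mat_scale c (mat 1)"
    unfolding mat_conj_scale by (simp add: mat_conj_def matrix_inv_cancel[OF assms])
  then show ?thesis by (simp add: mat_scale_eq_mat_mult)
qed

lemma mat_conj_mat_conj: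
  assumes "invertible s" "invertible t"
  shows "mat_conj t (mat_conj s A) = mat_conj (s ** t) A"
proof -
  have "matrix_inv (s ** t) = matrix_inv t ** matrix_inv s"
  proof (rule matrix_inv_unique)
    have "s ** t ** (matrix_inv t ** matrix_inv s) = s ** (t ** matrix_inv t) ** matrix_inv s"
      by (simp add: matrix_mul_assoc)
    then show "s ** t ** (matrix_inv t ** matrix_inv s) = mat 1"
      by (simp add: matrix_inv_cancel[OF assms(1)] matrix_inv_cancel[OF assms(2)])
    have "matrix_inv t ** matrix_inv s ** (s ** t) = matrix_inv t ** (matrix_inv s ** s) ** t"
      by (simp add: matrix_mul_assoc)
    then show "matrix_inv t ** matrix_inv s ** (s ** t) = mat 1"
      by (simp add: matrix_inv_cancel[OF assms(1)] matrix_inv_cancel[OF assms(2)])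
  qed
  then show ?thesis by (simp add: mat_conj_def matrix_mul_assoc)
qed

lemma tuple_conj_nth [simp]: "tuple_conj s z $ i = mat_conj s (z $ i)"
  by (simp add: tuple_conj_def)

lemma tuple_conj_tuple_conj:
  "invertible s \<Longrightarrow> invertible t \<Longrightarrow> tuple_conj t (tuple_conj s z) = tuple_conj (s ** t) z"
  by (simp add: vec_eq_iff[of "tuple_conj _ _"] mat_conj_mat_conj)

lemma mat_conj_one [simp]: "mat_conj (mat 1) A = A"
  by (simp add: mat_conj_def matrix_inv_unique[of "mat 1" "mat 1"])

lemma tuple_conj_one [simp]: "tuple_conj (mat 1) z = z"
  by (simp add: vec_eq_iff[of "tuple_conj _ _"])

lemma trace_mat_conj: "invertible s \<Longrightarrow> trace (mat_conj s A) = trace A"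
  unfolding mat_conj_def
  by (metis matrix_inv_cancel(1) matrix_mul_assoc matrix_mul_lid trace_mul_sym)

text \<open>The conjugate transpose, which is the inverse of a unitary matrix.\<close>

abbreviation adj :: "'n::finite cmat \<Rightarrow> 'n cmat"
  where "adj k \<equiv> map_matrix cnj (transpose k)"

lemma adj_mult: "adj (k ** l) = adj l ** adj k"
  by (simp add: vec_eq_iff matrix_matrix_mult_def transpose_def mult.commute)

lemma adj_adj: "adj (adj k) = k"
  by (simp add: vec_eq_iff transpose_def)

lemma unitary_one: "unitary (mat 1)"
proof -
  have "adj (mat 1 :: 'n::finite cmat) = mat 1"
    by (simp add: vec_eq_iff mat_def transpose_def)
  then show ?thesis by (simp add: unitary_def)
qed

lemma unitary_adj: "unitary k \<Longrightarrow> unitary (adj k)"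
  by (simp add: unitary_def adj_adj)

lemma unitary_mult:
  assumes "unitary k" "unitary l"
  shows "unitary (k ** l)"
proof -
  have "k ** l ** (adj l ** adj k) = k ** (l ** adj l) ** adj k" 
    and "adj l ** adj k ** (k ** l) = adj l ** (adj k ** k) ** l"
    by (simp_all only: matrix_mul_assoc)
  with assms show ?thesis by (simp add: unitary_def adj_mult)
qed

lemma unitary_invertible: "unitary k \<Longrightarrow> invertible k"
  by (auto simp: unitary_def invertible_def)

lemma matrix_inv_unitary: "unitary k \<Longrightarrow> matrix_inv k = adj k"
  by (simp add: unitary_def matrix_inv_unique)

lemma mat_conj_adj_cancel: "unitary k \<Longrightarrow> mat_conj (adj k) (mat_conj k A) = A"
  by (simp add: mat_conj_mat_conj unitary_invertible unitary_adj)
     (simp add: unitary_def)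

lemma tuple_conj_adj_cancel: "unitary k \<Longrightarrow> tuple_conj (adj k) (tuple_conj k z) = z"
  by (simp add: vec_eq_iff[of "tuple_conj _ _"] mat_conj_adj_cancel)

lemma norm_eq_inner_cnj: "complex_of_real ((norm v)\<^sup>2) = (\<Sum>i\<in>UNIV. cnj (v $ i) * (v $ i))"
  for v :: "complex ^ 'n::finite"
proof -
  have "(norm v)\<^sup>2 = (\<Sum>i\<in>UNIV. (norm (v $ i))\<^sup>2)"
    by (simp add: norm_vec_def L2_set_def sum_nonneg)
  then show ?thesis by (simp add: of_real_sum complex_norm_square mult.commute del: of_real_power)
qed

lemma norm_unitary_mult:
  fixes k :: "'n::finite cmat"
  assumes "unitary k"
  shows "norm (k *v v) = norm v"
proof -
  have *: "(\<Sum>i\<in>UNIV. cnj (w $ i) * (k *v v) $ i) = (\<Sum>j\<in>UNIV. cnj ((adj k *v w) $ j) * v $ j)" for w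
  proof -
    have "(\<Sum>i\<in>UNIV. cnj (w $ i) * (k *v v) $ i) = (\<Sum>i\<in>UNIV. \<Sum>j\<in>UNIV. cnj (w $ i) * k $ i $ j * v $ j)"
      by (simp add: matrix_vector_mult_def sum_distrib_left mult.assoc)
    also have "\<dots> = (\<Sum>j\<in>UNIV. \<Sum>i\<in>UNIV. cnj (w $ i) * k $ i $ j * v $ j)"
      by (rule sum.swap)
    also have "\<dots> = (\<Sum>j\<in>UNIV. cnj ((adj k *v w) $ j) * v $ j)"
      by (simp add: matrix_vector_mult_def sum_distrib_right sum_distrib_left transpose_def mult_ac)
    finally show ?thesis .
  qed
  have "adj k *v (k *v v) = v"
    using assms by (simp add: matrix_vector_mul_assoc unitary_def)
  then have "complex_of_real ((norm (k *v v))\<^sup>2) = complex_of_real ((norm v)\<^sup>2)"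
    using *[of "k *v v"] by (simp only: norm_eq_inner_cnj)
  then show ?thesis by (simp add: of_real_eq_iff del: of_real_power)
qed

text \<open>The norm of the \<open>C\<^sup>*\<close>-algebra of matrices, in the form in which it enters the norm of a fibre.\<close>

abbreviation opnorm :: "'n::finite cmat \<Rightarrow> real"
  where "opnorm A \<equiv> onorm (\<lambda>v. A *v v)"

lemma opnorm_nonneg: "0 \<le> opnorm A"
  by (rule onorm_pos_le) simp

lemma opnorm_zero [simp]: "opnorm 0 = 0"
  by (simp add: onorm_zero)

lemma opnorm_triangle: "opnorm (A + B) \<le> opnorm A + opnorm B"
  using onorm_triangle[of "(*v) A" "(*v) B"] by (simp add: matrix_vector_mult_add_rdistrib)

lemma opnorm_mult: "opnorm (A ** B) \<le> opnorm A * opnorm B"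
  using onorm_compose[of "(*v) A" "(*v) B"] by (simp add: o_def matrix_vector_mul_assoc)

lemma mat_scale_vector_mult: "mat_scale c A *v v = c *s (A *v v)"
  by (simp add: vec_eq_iff matrix_vector_mult_def sum_distrib_left mult.assoc)

lemma norm_vector_scalar_mult: "norm (c *s v) = norm c * norm v" for v :: "complex ^ 'n::finite"
proof -
  have "norm (c *s v) = sqrt (\<Sum>i\<in>UNIV. (norm c)\<^sup>2 * (norm (v $ i))\<^sup>2)"
    by (simp add: norm_vec_def L2_set_def norm_mult power_mult_distrib)
  also have "\<dots> = norm c * norm v"
    by (simp add: sum_distrib_left[symmetric] real_sqrt_mult norm_vec_def L2_set_def)
  finally show ?thesis .
qed

lemma opnorm_scale: "opnorm (mat_scale c A) \<le> norm c * opnorm A"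
proof (rule onorm_le)
  fix v
  have "norm (A *v v) \<le> opnorm A * norm v" by (rule onorm) simp
  then have "norm c * norm (A *v v) \<le> norm c * (opnorm A * norm v)" by (rule mult_left_mono) simp
  then show "norm (mat_scale c A *v v) \<le> norm c * opnorm A * norm v"
    by (simp add: mat_scale_vector_mult norm_vector_scalar_mult mult.assoc)
qed

lemma opnorm_uminus: "opnorm (- A) = opnorm A"
proof -
  have "- A = mat_scale (-1) A" "A = mat_scale (-1) (- A)" by (simp_all add: vec_eq_iff)
  then show ?thesis using opnorm_scale[of "-1" A] opnorm_scale[of "-1" "-A"] by simp
qed

lemma norm_nth_le_opnorm: "norm (A $ i $ j) \<le> opnorm A"
proof -
  have "A $ i $ j = (A *v axis j 1) $ i"
    by (simp add: matrix_vector_mult_def axis_def if_distrib cong: if_cong)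
  then have "norm (A $ i $ j) \<le> norm (A *v axis j 1)" by (metis component_le_norm_cart Finite_Cartesian_Product.norm_nth_le)
  also have "\<dots> \<le> opnorm A * norm (axis j 1 :: complex ^ 'a)" by (rule onorm) simp
  also have "norm (axis j 1 :: complex ^ 'a) = 1"
    by (simp add: norm_vec_def L2_set_def axis_def if_distrib if_distribR cong: if_cong)
  finally show ?thesis by simp
qed

lemma opnorm_le_sum: "opnorm A \<le> (\<Sum>i\<in>UNIV. \<Sum>j\<in>UNIV. norm (A $ i $ j))"
proof (rule onorm_le)
  fix v
  have "norm (A *v v) \<le> (\<Sum>i\<in>UNIV. norm ((A *v v) $ i))" 
    unfolding norm_vec_def by (rule L2_set_le_sum) simp
  also have "\<dots> \<le> (\<Sum>i\<in>UNIV. \<Sum>j\<in>UNIV. norm (A $ i $ j) * norm v)"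
  proof (intro sum_mono)
    fix i
    have "norm ((A *v v) $ i) \<le> (\<Sum>j\<in>UNIV. norm (A $ i $ j * v $ j))"
      unfolding matrix_vector_mult_def by (simp add: norm_sum)
    also have "\<dots> \<le> (\<Sum>j\<in>UNIV. norm (A $ i $ j) * norm v)"
      by (intro sum_mono) (simp add: norm_mult mult_left_mono Finite_Cartesian_Product.norm_nth_le)
    finally show "norm ((A *v v) $ i) \<le> (\<Sum>j\<in>UNIV. norm (A $ i $ j) * norm v)" .
  qed
  also have "\<dots> = (\<Sum>i\<in>UNIV. \<Sum>j\<in>UNIV. norm (A $ i $ j)) * norm v"
    by (simp add: sum_distrib_right)
  finally show "norm (A *v v) \<le> \<dots>" .
qed

lemma opnorm_diff_le: "\<bar>opnorm A - opnorm B\<bar> \<le> opnorm (A - B)"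
  using opnorm_triangle[of "A - B" B] opnorm_triangle[of "B - A" A] opnorm_uminus[of "A - B"] by simp

lemma continuous_on_opnorm [continuous_intros]:
  fixes f :: "'a::topological_space \<Rightarrow> 'n::finite cmat"
  assumes "continuous_on S f"
  shows "continuous_on S (\<lambda>x. opnorm (f x))"
  unfolding continuous_on_def
proof
  fix x assume x: "x \<in> S"
  have "((\<lambda>y. \<Sum>i\<in>UNIV. \<Sum>j\<in>UNIV. norm ((f y - f x) $ i $ j)) \<longlongrightarrow>
     (\<Sum>i\<in>UNIV. \<Sum>j\<in>UNIV. norm ((f x - f x) $ i $ j))) (at x within S)"
    using assms x unfolding continuous_on_def by (intro tendsto_intros) blast+
  then have lim: "((\<lambda>y. \<Sum>i\<in>UNIV. \<Sum>j\<in>UNIV. norm ((f y - f x) $ i $ j)) \<longlongrightarrow> 0) (at x within S)"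
    by simp
  have "((\<lambda>y. opnorm (f y) - opnorm (f x)) \<longlongrightarrow> 0) (at x within S)"
    using order_trans[OF opnorm_diff_le opnorm_le_sum]
    by (intro Lim_null_comparison[OF _ lim] always_eventually allI) (simp only: real_norm_def)
  then show "((\<lambda>y. opnorm (f y)) \<longlongrightarrow> opnorm (f x)) (at x within S)"
    by (rule Lim_null[THEN iffD2])
qed

lemma opnorm_mat_conj: 
  assumes "unitary k"
  shows "opnorm (mat_conj k A) = opnorm A"
proof -
  have u: "opnorm l \<le> 1" if "unitary l" for l :: "'a cmat"
    using norm_unitary_mult[OF that] by (intro onorm_le) simp
  have le: "opnorm (mat_conj l B) \<le> opnorm B" if l: "unitary l" for l B :: "'a cmat"
  proof -
    have "opnorm (mat_conj l B) \<le> opnorm (adj l) * opnorm B * opnorm l"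
      unfolding mat_conj_def matrix_inv_unitary[OF l]
      by (meson opnorm_mult opnorm_nonneg mult_right_mono order_trans)
    also have "\<dots> \<le> 1 * opnorm B * 1"
      by (intro mult_mono u l unitary_adj opnorm_nonneg mult_nonneg_nonneg) simp_all
    finally show ?thesis by simp
  qed
  show ?thesis
    using le[OF assms, of A] le[OF unitary_adj[OF assms], of "mat_conj k A"]
    by (simp add: mat_conj_adj_cancel assms)
qed

lemma continuous_on_mat_mult [continuous_intros]:
  fixes f g :: "'a::topological_space \<Rightarrow> 'n::finite cmat"
  assumes "continuous_on S f" "continuous_on S g"
  shows "continuous_on S (\<lambda>x. f x ** g x)"
proof -
  have "continuous_on S (\<lambda>x. \<chi> i j. \<Sum>k\<in>UNIV. f x $ i $ k * g x $ k $ j)"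
    using assms by (intro continuous_intros)
  then show ?thesis by (simp add: matrix_matrix_mult_def)
qed

lemma continuous_on_mat_scale [continuous_intros]:
  fixes f :: "'a::topological_space \<Rightarrow> 'n::finite cmat"
  assumes "continuous_on S f" "continuous_on S c"
  shows "continuous_on S (\<lambda>x. mat_scale (c x) (f x))"
proof -
  have "continuous_on S (\<lambda>x. \<chi> i j. c x * f x $ i $ j)"
    using assms by (intro continuous_intros)
  then show ?thesis by (simp add: mat_scale_def map_matrix_def)
qed

section \<open>Invariants and the trace algebra\<close>

lemma polynomial_functions_coordinate: "(\<lambda>z. z $ i $ j $ k) \<in> polynomial_functions"
  unfolding polynomial_functions_def by (rule hull_inc) blast

lemma polynomial_functions_unital_subalgebra:
  "unital_subalgebra (\<lambda>x. 1) (\<lambda>f g x. f x + g x) (\<lambda>c f x. c * f x) (\<lambda>f g x. f x * g x)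
     polynomial_functions"
  unfolding polynomial_functions_def scalar_fun_subalgebra_def by (rule unital_subalgebra_hull)

lemma polynomial_functions_1: "(\<lambda>z. 1) \<in> polynomial_functions"
  and polynomial_functions_add:
    "p \<in> polynomial_functions \<Longrightarrow> q \<in> polynomial_functions \<Longrightarrow> (\<lambda>z. p z + q z) \<in> polynomial_functions"
  and polynomial_functions_mult:
    "p \<in> polynomial_functions \<Longrightarrow> q \<in> polynomial_functions \<Longrightarrow> (\<lambda>z. p z * q z) \<in> polynomial_functions"
  and polynomial_functions_scale: "p \<in> polynomial_functions \<Longrightarrow> (\<lambda>z. c * p z) \<in> polynomial_functions"
  using polynomial_functions_unital_subalgebra unfolding unital_subalgebra_def by blast+

lemma polynomial_functions_const: "(\<lambda>z. c) \<in> polynomial_functions"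
  using polynomial_functions_scale[OF polynomial_functions_1, of c] by simp

lemma polynomial_functions_sum:
  "finite I \<Longrightarrow> (\<And>i. i \<in> I \<Longrightarrow> p i \<in> polynomial_functions) \<Longrightarrow> (\<lambda>z. \<Sum>i\<in>I. p i z) \<in> polynomial_functions"
  by (induction I rule: finite_induct) (auto intro: polynomial_functions_add polynomial_functions_const)

lemma polynomial_functions_continuous: "p \<in> polynomial_functions \<Longrightarrow> continuous_on S p"
proof -
  assume p: "p \<in> polynomial_functions"
  have "continuous_on UNIV p"
    using p unfolding polynomial_functions_def
    by (rule hull_induct)
       (auto simp: scalar_fun_subalgebra_def unital_subalgebra_def intro!: continuous_intros)
  then show ?thesis by (rule continuous_on_subset) simp
qed

lemma polynomial_functions_holomorphic_on_line:
  assumes "p \<in> polynomial_functions"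
  shows "(\<lambda>\<zeta>. p (z + (\<chi> i. mat_scale \<zeta> (w $ i)))) holomorphic_on S"
  using assms unfolding polynomial_functions_def
  by (rule hull_induct)
     (auto simp: scalar_fun_subalgebra_def unital_subalgebra_def intro!: holomorphic_intros)

lemma
  shows invariants_const: "(\<lambda>z. c) \<in> invariants"
    and invariants_add: "p \<in> invariants \<Longrightarrow> q \<in> invariants \<Longrightarrow> (\<lambda>z. p z + q z) \<in> invariants"
    and invariants_mult: "p \<in> invariants \<Longrightarrow> q \<in> invariants \<Longrightarrow> (\<lambda>z. p z * q z) \<in> invariants"
    and invariants_scale: "p \<in> invariants \<Longrightarrow> (\<lambda>z. c * p z) \<in> invariants"
  by (auto simp: invariants_def polynomial_functions_const polynomial_functions_add
      polynomial_functions_mult polynomial_functions_scale)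

lemma trace_algebra_unital_subalgebra:
  "unital_subalgebra (\<lambda>x. mat 1) (\<lambda>f g x. f x + g x)
      (\<lambda>c f x. mat_scale c (f x)) (\<lambda>f g x. f x ** g x) trace_algebra"
  unfolding trace_algebra_def mat_fun_subalgebra_def by (rule unital_subalgebra_hull)

lemma trace_algebra_1: "(\<lambda>z. mat 1) \<in> trace_algebra"
  and trace_algebra_add: "\<phi> \<in> trace_algebra \<Longrightarrow> \<psi> \<in> trace_algebra \<Longrightarrow> (\<lambda>z. \<phi> z + \<psi> z) \<in> trace_algebra"
  and trace_algebra_mult: "\<phi> \<in> trace_algebra \<Longrightarrow> \<psi> \<in> trace_algebra \<Longrightarrow> (\<lambda>z. \<phi> z ** \<psi> z) \<in> trace_algebra"
  and trace_algebra_scale: "\<phi> \<in> trace_algebra \<Longrightarrow> (\<lambda>z. mat_scale c (\<phi> z)) \<in> trace_algebra"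
  using trace_algebra_unital_subalgebra unfolding unital_subalgebra_def by blast+

text \<open>Induction along the generators of the trace algebra, with the generic matrices and the
  invariants on the same level.\<close>

lemma trace_algebra_induct [consumes 1, case_names coordinate invariant one add scale mult]:
  assumes "\<phi> \<in> trace_algebra"
    and "\<And>i. Q (\<lambda>z. z $ i)" "\<And>p. p \<in> invariants \<Longrightarrow> Q (\<lambda>z. mat (p z))" "Q (\<lambda>z. mat 1)"
    and "\<And>\<phi> \<psi>. Q \<phi> \<Longrightarrow> Q \<psi> \<Longrightarrow> Q (\<lambda>z. \<phi> z + \<psi> z)"
    and "\<And>c \<phi>. Q \<phi> \<Longrightarrow> Q (\<lambda>z. mat_scale c (\<phi> z))"
    and "\<And>\<phi> \<psi>. Q \<phi> \<Longrightarrow> Q \<psi> \<Longrightarrow> Q (\<lambda>z. \<phi> z ** \<psi> z)"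
  shows "Q \<phi>"
proof -
  have sub: "mat_fun_subalgebra {\<phi>. Q \<phi>}"
    using assms by (simp add: mat_fun_subalgebra_def unital_subalgebra_def)
  have "Q \<psi>" if "\<psi> \<in> generic_matrix_algebra" for \<psi>
    using that unfolding generic_matrix_algebra_def
    by (rule hull_induct) (use sub assms in auto)
  then show ?thesis
    using assms(1) unfolding trace_algebra_def
    by (elim hull_induct) (use sub assms in auto)
qed

lemma trace_algebra_polynomial:
  assumes "\<phi> \<in> trace_algebra"
  shows "(\<lambda>z. \<phi> z $ j $ k) \<in> polynomial_functions"
  using assms
proof (induction arbitrary: j k rule: trace_algebra_induct)
  case (invariant p)
  then show ?case
    by (cases "j = k") (auto simp: mat_def invariants_def polynomial_functions_const)
next
  case one
  then show ?case by (simp add: polynomial_functions_const)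
next
  case (mult \<phi> \<psi>)
  then show ?case
    unfolding matrix_matrix_mult_def
    by (auto intro!: polynomial_functions_sum polynomial_functions_mult)
qed (auto intro: polynomial_functions_coordinate polynomial_functions_add polynomial_functions_scale)

lemma trace_algebra_equivariant:
  assumes "\<phi> \<in> trace_algebra" "invertible s"
  shows "\<phi> (tuple_conj s z) = mat_conj s (\<phi> z)"
  using assms(1)
  by (induction rule: trace_algebra_induct)
     (use assms(2) in \<open>simp_all add: mat_conj_mat mat_conj_add mat_conj_scale mat_conj_mult invariants_def\<close>)

lemma trace_algebra_continuous: "\<phi> \<in> trace_algebra \<Longrightarrow> continuous_on S \<phi>"
proof -
  assume "\<phi> \<in> trace_algebra"
  then have "continuous_on S (\<lambda>z. \<chi> j k. \<phi> z $ j $ k)"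
    by (intro continuous_on_vec_lambda polynomial_functions_continuous trace_algebra_polynomial)
  then show ?thesis by simp
qed

lemma trace_algebra_trace:
  assumes "\<phi> \<in> trace_algebra"
  shows "(\<lambda>z. trace (\<phi> z)) \<in> invariants"
  using assms unfolding invariants_def
  by (auto simp: trace_algebra_equivariant trace_mat_conj)
     (auto simp: trace_def intro!: polynomial_functions_sum trace_algebra_polynomial)

lemma trace_algebra_coordinate: "(\<lambda>z. z $ i) \<in> trace_algebra"
  unfolding trace_algebra_def generic_matrix_algebra_def by (blast intro: hull_inc)

text \<open>At a generating tuple the trace algebra takes every matrix as a value. This yields both the
  freeness of the conjugation action modulo scalars and, for any section, an element of the trace
  algebra that agrees with it at a given point.\<close>

lemma trace_algebra_interpolates:
  assumes "z \<in> generating_tuples"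
  obtains \<phi> where "\<phi> \<in> trace_algebra" "\<phi> z = A"
proof -
  have "mat_subalgebra {\<phi> z | \<phi>. \<phi> \<in> trace_algebra}"
    unfolding mat_subalgebra_def unital_subalgebra_def
  proof (intro conjI ballI allI)
    show "mat 1 \<in> {\<phi> z | \<phi>. \<phi> \<in> trace_algebra}"
      using trace_algebra_1 by (intro CollectI exI[of _ "\<lambda>z. mat 1"]) simp
  next
    fix a b assume "a \<in> {\<phi> z | \<phi>. \<phi> \<in> trace_algebra}" "b \<in> {\<phi> z | \<phi>. \<phi> \<in> trace_algebra}"
    then obtain \<phi> \<psi> where ab: "\<phi> \<in> trace_algebra" "\<psi> \<in> trace_algebra" "a = \<phi> z" "b = \<psi> z" by blast
    show "a + b \<in> {\<phi> z | \<phi>. \<phi> \<in> trace_algebra}"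
      using trace_algebra_add[OF ab(1,2)] ab(3,4) by (intro CollectI exI conjI) auto
    show "a ** b \<in> {\<phi> z | \<phi>. \<phi> \<in> trace_algebra}"
      using trace_algebra_mult[OF ab(1,2)] ab(3,4) by (intro CollectI exI conjI) auto
  next
    fix c a assume "a \<in> {\<phi> z | \<phi>. \<phi> \<in> trace_algebra}"
    then obtain \<phi> where a: "\<phi> \<in> trace_algebra" "a = \<phi> z" by blast
    show "mat_scale c a \<in> {\<phi> z | \<phi>. \<phi> \<in> trace_algebra}"
      using trace_algebra_scale[OF a(1)] a(2) by (intro CollectI exI conjI) auto
  qed
  moreover have "range (\<lambda>i. z $ i) \<subseteq> {\<phi> z | \<phi>. \<phi> \<in> trace_algebra}"
  proof
    fix a assume "a \<in> range (\<lambda>i. z $ i)"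
    then obtain i where "a = z $ i" by blast
    then show "a \<in> {\<phi> z | \<phi>. \<phi> \<in> trace_algebra}"
      using trace_algebra_coordinate[of i] by (intro CollectI exI conjI) auto
  qed
  ultimately have "mat_subalgebra hull (range (\<lambda>i. z $ i)) \<subseteq> {\<phi> z | \<phi>. \<phi> \<in> trace_algebra}"
    by (rule hull_minimal[rotated])
  then have "A \<in> {\<phi> z | \<phi>. \<phi> \<in> trace_algebra}"
    using assms by (auto simp: generating_tuples_def)
  then show ?thesis using that by blast
qed

lemma mat_conj_eq_of_fixed_generating:
  assumes z: "z \<in> generating_tuples" and s: "invertible s" and fix_z: "tuple_conj s z = z"
  shows "mat_conj s A = A"
proof -
  obtain \<phi> where "\<phi> \<in> trace_algebra" "\<phi> z = A" using trace_algebra_interpolates[OF z] .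
  then show ?thesis using trace_algebra_equivariant[OF _ s, of \<phi> z] fix_z by simp
qed

section \<open>Sections of the associated bundle as equivariant functions\<close>

text \<open>Equivariant matrix functions on a set of tuples. Those on the total space of a reduction represent
  sections of the associated bundle. Only unitary conjugations are considered, since they act on it.\<close>

definition equivariant_on :: "('d::finite, 'n::finite) tuple set \<Rightarrow> (('d, 'n) tuple \<Rightarrow> 'n cmat) \<Rightarrow> bool"
  where "equivariant_on S F \<longleftrightarrow> (\<forall>z\<in>S. \<forall>k. unitary k \<longrightarrow> F (tuple_conj k z) = mat_conj k (F z))"

lemma trace_algebra_equivariant_on: "\<phi> \<in> trace_algebra \<Longrightarrow> equivariant_on S \<phi>"
  by (simp add: equivariant_on_def trace_algebra_equivariant unitary_invertible)

lemma pi0_tuple_conj: "invertible s \<Longrightarrow> pi0 (tuple_conj s z) = pi0 z"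
  unfolding pi0_def by (rule restrict_ext) (simp add: invariants_def)

text \<open>A reduction \<open>P\<close> of the generating tuples to the unitary group over a set \<open>C\<close> of classes,
  together with a relatively closed subset \<open>X\<close> of \<open>C\<close> over which sections are considered.
  It is used with \<open>C\<close> the closure of a domain and \<open>X\<close> its Shilov boundary.\<close>

locale unitary_reduction =
  fixes C X :: "('d::finite, 'n::finite) qpoint set" and P :: "('d, 'n) tuple set"
  assumes compact_P: "compact P"
    and generating: "z \<in> P \<Longrightarrow> z \<in> generating_tuples"
    and P_invariant: "unitary k \<Longrightarrow> z \<in> P \<Longrightarrow> tuple_conj k z \<in> P"
    and quotient_pi0: "quotient_map (top_of_set P) (subtopology Q_top C) pi0"
    and fibre: "z \<in> P \<Longrightarrow> w \<in> P \<Longrightarrow> pi0 z = pi0 w \<Longrightarrow> \<exists>k. unitary k \<and> w = tuple_conj k z"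
    and C_subset: "C \<subseteq> topspace Q_top"
    and closedin_X: "closedin (subtopology Q_top C) X"
begin

text \<open>The part of the total space that lies over \<open>X\<close>.\<close>

definition PX :: "('d, 'n) tuple set"
  where "PX = {z \<in> P. pi0 z \<in> X}"

abbreviation cls :: "('d, 'n) tuple \<Rightarrow> 'n cmat \<Rightarrow> ('d, 'n) bundle_pt"
  where "cls \<equiv> bundle_class P"

lemma PX_subset: "z \<in> PX \<Longrightarrow> z \<in> P"
  by (simp add: PX_def)

lemma X_subset_C: "X \<subseteq> C"
  using closedin_subset[OF closedin_X] by simp

lemma pi0_image: "pi0 ` P = C"
  using quotient_imp_surjective_map[OF quotient_pi0] C_subset by auto

lemma pi0_image_PX: "pi0 ` PX = X"
  using pi0_image X_subset_C by (auto simp: PX_def)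

lemma pi0_in_X: "z \<in> PX \<Longrightarrow> pi0 z \<in> X"
  by (simp add: PX_def)

lemma X_eq_pi0: "x \<in> X \<Longrightarrow> \<exists>z\<in>PX. x = pi0 z"
  using pi0_image_PX by blast

lemma PX_invariant: "unitary k \<Longrightarrow> z \<in> PX \<Longrightarrow> tuple_conj k z \<in> PX"
  by (simp add: PX_def P_invariant pi0_tuple_conj unitary_invertible)

lemma compact_PX: "compact PX"
proof -
  have "closedin (top_of_set P) {z \<in> topspace (top_of_set P). pi0 z \<in> X}"
    by (rule closedin_continuous_map_preimage[OF quotient_imp_continuous_map[OF quotient_pi0] closedin_X])
  then show ?thesis
    using closedin_compact[OF compact_P] by (simp add: PX_def)
qed

lemma quotient_pi0_PX: "quotient_map (top_of_set PX) (subtopology Q_top X) pi0"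
proof -
  have "quotient_map (subtopology (top_of_set P) PX) (subtopology (subtopology Q_top C) X) pi0"
    by (rule quotient_map_restriction[OF quotient_pi0]) (auto simp: PX_def closedin_X)
  moreover have "P \<inter> PX = PX" "C \<inter> X = X" using X_subset_C by (auto simp: PX_def)
  ultimately show ?thesis by (simp add: subtopology_subtopology)
qed

lemma mem_cls_iff:
  "z \<in> P \<Longrightarrow> (w, B) \<in> cls z A \<longleftrightarrow> (\<exists>k. unitary k \<and> w = tuple_conj k z \<and> B = mat_conj k A)"
  by (auto simp: bundle_class_def bundle_rel_def)

lemma cls_conj:
  assumes z: "z \<in> P" and k: "unitary k"
  shows "cls (tuple_conj k z) (mat_conj k A) = cls z A"
proof (rule set_eqI, clarify)
  fix w B
  have kz: "tuple_conj k z \<in> P" using P_invariant z k by blast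
  show "(w, B) \<in> cls (tuple_conj k z) (mat_conj k A) \<longleftrightarrow> (w, B) \<in> cls z A"
  proof
    assume "(w, B) \<in> cls (tuple_conj k z) (mat_conj k A)"
    then obtain l where "unitary l" "w = tuple_conj l (tuple_conj k z)" "B = mat_conj l (mat_conj k A)"
      using mem_cls_iff[OF kz] by blast
    then show "(w, B) \<in> cls z A"
      using k by (auto simp: mem_cls_iff[OF z] tuple_conj_tuple_conj mat_conj_mat_conj
          unitary_invertible intro: unitary_mult)
  next
    assume "(w, B) \<in> cls z A"
    then obtain l where l: "unitary l" "w = tuple_conj l z" "B = mat_conj l A"
      using mem_cls_iff[OF z] by blast
    have "w = tuple_conj (adj k ** l) (tuple_conj k z)" "B = mat_conj (adj k ** l) (mat_conj k A)"
      using l k tuple_conj_tuple_conj[of "adj k" l "tuple_conj k z"] mat_conj_mat_conj[of "adj k" l "mat_conj k A"]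
      by (simp_all add: unitary_invertible unitary_adj tuple_conj_adj_cancel mat_conj_adj_cancel)
    moreover have "unitary (adj k ** l)" using l k unitary_mult unitary_adj by blast
    ultimately show "(w, B) \<in> cls (tuple_conj k z) (mat_conj k A)"
      using mem_cls_iff[OF kz] by blast
  qed
qed

lemma mem_cls_self_iff:
  assumes z: "z \<in> P"
  shows "(z, B) \<in> cls z A \<longleftrightarrow> B = A"
proof
  assume "(z, B) \<in> cls z A"
  then obtain k where k: "unitary k" "tuple_conj k z = z" "B = mat_conj k A"
    using mem_cls_iff[OF z] by metis
  then show "B = A"
    using mat_conj_eq_of_fixed_generating[OF generating[OF z] unitary_invertible] by blast
next
  assume "B = A"
  then show "(z, B) \<in> cls z A"
    unfolding mem_cls_iff[OF z] using unitary_one by (intro exI[of _ "mat 1"]) simp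
qed

lemma mem_cls_conj_iff:
  assumes "z \<in> P" "unitary k"
  shows "(tuple_conj k z, B) \<in> cls z A \<longleftrightarrow> B = mat_conj k A"
  using mem_cls_self_iff[OF P_invariant[OF assms(2,1)], of B "mat_conj k A"] cls_conj[OF assms] by simp

lemma bundle_proj_cls: 
  assumes z: "z \<in> P"
  shows "bundle_proj (cls z A) = pi0 z"
  unfolding bundle_proj_def
proof (rule the_equality)
  show "\<exists>w B. (w, B) \<in> cls z A \<and> pi0 z = pi0 w" using mem_cls_self_iff[OF z] by blast
qed (auto simp: mem_cls_iff[OF z] pi0_tuple_conj unitary_invertible)

lemma fib_add_cls:
  assumes z: "z \<in> P"
  shows "fib_add (cls z A) (cls z B) = cls z (A + B)"
proof (rule set_eqI, clarify)
  fix w M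
  show "(w, M) \<in> fib_add (cls z A) (cls z B) \<longleftrightarrow> (w, M) \<in> cls z (A + B)"
  proof
    assume "(w, M) \<in> fib_add (cls z A) (cls z B)"
    then obtain A' B' where M: "(w, A') \<in> cls z A" "(w, B') \<in> cls z B" "M = A' + B'"
      by (auto simp: fib_add_def)
    then obtain k where k: "unitary k" "w = tuple_conj k z" "A' = mat_conj k A"
      using mem_cls_iff[OF z] by blast
    then have "B' = mat_conj k B" using M(2) mem_cls_conj_iff[OF z] by blast
    then show "(w, M) \<in> cls z (A + B)"
      using k M(3) mem_cls_iff[OF z] by (auto simp: mat_conj_add)
  next
    assume "(w, M) \<in> cls z (A + B)"
    then obtain k where k: "unitary k" "w = tuple_conj k z" "M = mat_conj k A + mat_conj k B"
      using mem_cls_iff[OF z] by (auto simp: mat_conj_add)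
    then show "(w, M) \<in> fib_add (cls z A) (cls z B)"
      unfolding fib_add_def using mem_cls_conj_iff[OF z k(1)] by blast
  qed
qed

lemma fib_mult_cls:
  assumes z: "z \<in> P"
  shows "fib_mult (cls z A) (cls z B) = cls z (A ** B)"
proof (rule set_eqI, clarify)
  fix w M
  show "(w, M) \<in> fib_mult (cls z A) (cls z B) \<longleftrightarrow> (w, M) \<in> cls z (A ** B)"
  proof
    assume "(w, M) \<in> fib_mult (cls z A) (cls z B)"
    then obtain A' B' where M: "(w, A') \<in> cls z A" "(w, B') \<in> cls z B" "M = A' ** B'"
      by (auto simp: fib_mult_def)
    then obtain k where k: "unitary k" "w = tuple_conj k z" "A' = mat_conj k A"
      using mem_cls_iff[OF z] by blast
    then have "B' = mat_conj k B" using M(2) mem_cls_conj_iff[OF z] by blast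
    then show "(w, M) \<in> cls z (A ** B)"
      using k M(3) mem_cls_iff[OF z] by (auto simp: mat_conj_mult[OF unitary_invertible])
  next
    assume "(w, M) \<in> cls z (A ** B)"
    then obtain k where k: "unitary k" "w = tuple_conj k z" "M = mat_conj k A ** mat_conj k B"
      using mem_cls_iff[OF z] by (auto simp: mat_conj_mult[OF unitary_invertible])
    then show "(w, M) \<in> fib_mult (cls z A) (cls z B)"
      unfolding fib_mult_def using mem_cls_conj_iff[OF z k(1)] by blast
  qed
qed

lemma fib_scale_cls: 
  assumes z: "z \<in> P"
  shows "fib_scale c (cls z A) = cls z (mat_scale c A)"
  unfolding fib_scale_def set_eq_iff split_paired_All
  by (auto simp: mem_cls_iff[OF z] mat_conj_scale)

lemma fib_norm_cls: 
  assumes z: "z \<in> P"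
  shows "fib_norm (cls z A) = opnorm A"
  unfolding fib_norm_def
proof (rule the_equality)
  show "\<exists>w B. (w, B) \<in> cls z A \<and> opnorm A = opnorm B" using mem_cls_self_iff[OF z] by blast
qed (auto simp: mem_cls_iff[OF z] opnorm_mat_conj)

lemma quotient_cls: "quotient_map (top_of_set (P \<times> UNIV)) (bundle_top P) (\<lambda>(z, A). cls z A)"
  unfolding bundle_top_def by (rule quotient_map_quotient_topology)

lemma Psi_pi0:
  assumes F: "equivariant_on PX F" and z: "z \<in> PX"
  shows "Psi X P F (pi0 z) = cls z (F z)"
proof -
  have "(THE e. \<exists>w\<in>P. pi0 w = pi0 z \<and> e = cls w (F w)) = cls z (F z)"
  proof (rule the_equality)
    show "\<exists>w\<in>P. pi0 w = pi0 z \<and> cls z (F z) = cls w (F w)" using z PX_subset by blast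
  next
    fix e assume "\<exists>w\<in>P. pi0 w = pi0 z \<and> e = cls w (F w)"
    then obtain w k where "unitary k" "w = tuple_conj k z" "e = cls w (F w)"
      using fibre[OF PX_subset[OF z]] by metis
    then show "e = cls z (F z)"
      using F z cls_conj[OF PX_subset[OF z]] by (simp add: equivariant_on_def)
  qed
  then show ?thesis using z by (simp add: Psi_def PX_def)
qed

lemma section_eqI:
  assumes "\<sigma> \<in> extensional X" "\<tau> \<in> extensional X" "\<And>z. z \<in> PX \<Longrightarrow> \<sigma> (pi0 z) = \<tau> (pi0 z)"
  shows "\<sigma> = \<tau>"
proof (rule extensionalityI[OF assms(1,2)])
  fix u assume "u \<in> X"
  then obtain z where "z \<in> PX" "u = pi0 z" using pi0_image_PX by blast
  then show "\<sigma> u = \<tau> u" using assms(3) by simp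
qed

lemma Psi_extensional: "Psi X P F \<in> extensional X"
  by (simp add: Psi_def)

lemma Psi_in_Gamma_c:
  assumes F: "equivariant_on PX F" "continuous_on PX F"
  shows "Psi X P F \<in> Gamma_c X P"
  unfolding Gamma_c_def
proof (intro CollectI conjI ballI)
  have "continuous_map (top_of_set PX) (top_of_set (P \<times> UNIV)) (\<lambda>z. (z, F z))"
    using F(2) by (auto simp: PX_def intro!: continuous_intros)
  then have "continuous_map (top_of_set PX) (bundle_top P) ((\<lambda>(z, A). cls z A) \<circ> (\<lambda>z. (z, F z)))"
    using continuous_map_compose quotient_imp_continuous_map[OF quotient_cls] by blast
  then have "continuous_map (top_of_set PX) (bundle_top P) (Psi X P F \<circ> pi0)"
    by (rule continuous_map_eq) (simp add: Psi_pi0[OF F(1)])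
  then show "continuous_map (subtopology Q_top X) (bundle_top P) (Psi X P F)"
    by (rule continuous_compose_quotient_map[OF quotient_pi0_PX])
next
  fix u assume "u \<in> X"
  then obtain z where "z \<in> PX" "u = pi0 z" using pi0_image_PX by blast
  then show "bundle_proj (Psi X P F u) = u"
    by (simp add: Psi_pi0[OF F(1)] bundle_proj_cls PX_subset)
qed (rule Psi_extensional)

lemma Gamma_c_cls:
  assumes \<sigma>: "\<sigma> \<in> Gamma_c X P" and z: "z \<in> PX"
  shows "\<exists>A. \<sigma> (pi0 z) = cls z A"
proof -
  have u: "pi0 z \<in> X" using z by (simp add: PX_def)
  moreover have "continuous_map (subtopology Q_top X) (bundle_top P) \<sigma>" using \<sigma> by (simp add: Gamma_c_def)
  moreover have "pi0 z \<in> topspace (subtopology Q_top X)"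
    using u X_subset_C C_subset by auto
  ultimately have "\<sigma> (pi0 z) \<in> topspace (bundle_top P)" by (blast dest: continuous_map_funspace)
  then have "\<sigma> (pi0 z) \<in> (\<lambda>(z, A). cls z A) ` (P \<times> UNIV)"
    using quotient_imp_surjective_map[OF quotient_cls] by simp
  then obtain w B where w: "w \<in> P" "\<sigma> (pi0 z) = cls w B" by auto
  moreover have "bundle_proj (\<sigma> (pi0 z)) = pi0 z" using \<sigma> u by (simp add: Gamma_c_def)
  ultimately have "pi0 w = pi0 z" using bundle_proj_cls by simp
  then obtain k where "unitary k" "z = tuple_conj k w" using fibre[OF w(1) PX_subset[OF z]] by blast
  then show ?thesis using cls_conj[OF w(1), of k B] w(2) by metis
qed

text \<open>The fibrewise distance to the section of an element of the trace algebra is a continuous function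
  on the total space of the bundle.\<close>

lemma continuous_map_distance_to_trace_algebra:
  assumes \<phi>: "\<phi> \<in> trace_algebra"
  shows "\<exists>h. continuous_map (bundle_top P) euclidean h \<and>
    (\<forall>z\<in>P. \<forall>A. h (cls z A) = opnorm (A - \<phi> z))"
proof -
  define h where "h e = (THE r. \<exists>z A. (z, A) \<in> e \<and> r = opnorm (A - \<phi> z))" for e
  have h: "h (cls z A) = opnorm (A - \<phi> z)" if z: "z \<in> P" for z A
    unfolding h_def
  proof (rule the_equality)
    show "\<exists>w B. (w, B) \<in> cls z A \<and> opnorm (A - \<phi> z) = opnorm (B - \<phi> w)" using mem_cls_self_iff[OF z] by blast
  next
    fix r assume "\<exists>w B. (w, B) \<in> cls z A \<and> r = opnorm (B - \<phi> w)"
    then obtain k where k: "unitary k" "r = opnorm (mat_conj k A - \<phi> (tuple_conj k z))"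
      by (auto simp: mem_cls_iff[OF z])
    have "mat_conj k A - mat_conj k (\<phi> z) = mat_conj k (A - \<phi> z)"
      using mat_conj_add[of k "A - \<phi> z" "\<phi> z"] by simp
    then show "r = opnorm (A - \<phi> z)"
      using k by (simp add: trace_algebra_equivariant[OF \<phi>] unitary_invertible opnorm_mat_conj)
  qed
  have "continuous_on (P \<times> UNIV) (\<lambda>x. opnorm (snd x - \<phi> (fst x)))"
    by (intro continuous_intros continuous_on_compose2[OF trace_algebra_continuous[OF \<phi>, of UNIV]]) auto
  then have "continuous_map (top_of_set (P \<times> UNIV)) euclidean (\<lambda>x. opnorm (snd x - \<phi> (fst x)))"
    by simp
  then have "continuous_map (top_of_set (P \<times> UNIV)) euclidean (h \<circ> (\<lambda>(z, A). cls z A))"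
    by (rule continuous_map_eq) (auto simp: h)
  then have "continuous_map (bundle_top P) euclidean h"
    by (rule continuous_compose_quotient_map[OF quotient_cls])
  then show ?thesis using h by (intro exI[of _ h]) simp
qed

text \<open>Every continuous section comes from a continuous equivariant function \<open>F\<close>. Continuity of \<open>F\<close> at \<open>z\<close>
  is the point: with \<open>\<phi>\<close> in the trace algebra such that \<open>\<phi> z = F z\<close>, the distance from \<open>F\<close> to \<open>\<phi>\<close> is
  continuous because it factors through the section, and it vanishes at \<open>z\<close>.\<close>

lemma Gamma_c_imp_Psi:
  assumes \<sigma>: "\<sigma> \<in> Gamma_c X P"
  obtains F where "equivariant_on PX F" "continuous_on PX F" "\<sigma> = Psi X P F"
proof -
  obtain F where F: "\<And>z. z \<in> PX \<Longrightarrow> \<sigma> (pi0 z) = cls z (F z)"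
    using Gamma_c_cls[OF \<sigma>] by metis
  have eq: "equivariant_on PX F"
    unfolding equivariant_on_def
  proof (intro ballI allI impI)
    fix z and k :: "'n cmat" assume z: "z \<in> PX" and k: "unitary k"
    have "cls (tuple_conj k z) (F (tuple_conj k z)) = cls (tuple_conj k z) (mat_conj k (F z))"
      using F[OF z] F[OF PX_invariant[OF k z]] k cls_conj[OF PX_subset[OF z] k]
      by (simp add: pi0_tuple_conj unitary_invertible)
    then show "F (tuple_conj k z) = mat_conj k (F z)"
      using mem_cls_self_iff[OF PX_subset[OF PX_invariant[OF k z]]] by blast
  qed
  have "continuous_on PX F"
    unfolding continuous_on_def
  proof
    fix z assume z: "z \<in> PX"
    obtain \<phi> where \<phi>: "\<phi> \<in> trace_algebra" "\<phi> z = F z"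
      using trace_algebra_interpolates[OF generating[OF PX_subset[OF z]]] .
    obtain h where h: "continuous_map (bundle_top P) euclidean h"
      "\<And>z A. z \<in> P \<Longrightarrow> h (cls z A) = opnorm (A - \<phi> z)"
      using continuous_map_distance_to_trace_algebra[OF \<phi>(1)] by blast
    have "continuous_map (subtopology Q_top X) (bundle_top P) \<sigma>" using \<sigma> by (simp add: Gamma_c_def)
    then have "continuous_map (top_of_set PX) euclidean (h \<circ> (\<sigma> \<circ> pi0))"
      using continuous_map_compose[OF continuous_map_compose[OF quotient_imp_continuous_map[OF quotient_pi0_PX]]] h(1)
      by blast
    then have "continuous_map (top_of_set PX) euclidean (\<lambda>z. opnorm (F z - \<phi> z))"
      by (rule continuous_map_eq) (simp add: F h(2) PX_subset)
    then have "((\<lambda>w. opnorm (F w - \<phi> w)) \<longlongrightarrow> opnorm (F z - \<phi> z)) (at z within PX)"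
      using z by (simp add: continuous_on_def)
    then have lim: "((\<lambda>w. opnorm (F w - \<phi> w)) \<longlongrightarrow> 0) (at z within PX)"
      using \<phi>(2) by (simp add: onorm_zero)
    have "((\<lambda>w. (F w - \<phi> w) $ i $ j) \<longlongrightarrow> 0) (at z within PX)" for i j
      by (rule Lim_null_comparison[OF _ lim]) (intro always_eventually allI norm_nth_le_opnorm)
    then have "((\<lambda>w. \<chi> i j. (F w - \<phi> w) $ i $ j) \<longlongrightarrow> (\<chi> i j. 0)) (at z within PX)"
      by (intro tendsto_vec_lambda)
    then have "((\<lambda>w. F w - \<phi> w) \<longlongrightarrow> 0) (at z within PX)"
      by (simp add: zero_vec_def del: vector_minus_component)
    moreover have "(\<phi> \<longlongrightarrow> \<phi> z) (at z within PX)"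
      using trace_algebra_continuous[OF \<phi>(1), of PX] z by (simp add: continuous_on_def)
    ultimately show "(F \<longlongrightarrow> F z) (at z within PX)"
      using tendsto_add[of "\<lambda>w. F w - \<phi> w" 0 _ \<phi> "\<phi> z"] \<phi>(2) by simp
  qed
  moreover have "\<sigma> = Psi X P F"
    using \<sigma> by (intro section_eqI) (auto simp: Gamma_c_def Psi_extensional F Psi_pi0[OF eq])
  ultimately show ?thesis using eq that by blast
qed

end

section \<open>The closure of the trace algebra\<close>

lemma Sup_compact_less_iff:
  fixes S :: "real set"
  assumes "compact S" "S \<noteq> {}"
  shows "Sup S < e \<longleftrightarrow> (\<forall>x\<in>S. x < e)"
proof -
  obtain m where m: "m \<in> S" "\<forall>x\<in>S. x \<le> m" using compact_attains_sup[OF assms] by blast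
  then have "Sup S = m" by (intro cSup_eq_maximum) auto
  then show ?thesis using m by (auto intro: le_less_trans)
qed

context unitary_reduction
begin

lemma sec_add_Psi:
  assumes F: "equivariant_on PX F" and G: "equivariant_on PX G"
  shows "sec_add X (Psi X P F) (Psi X P G) = Psi X P (\<lambda>z. F z + G z)"
proof (rule section_eqI)
  have FG: "equivariant_on PX (\<lambda>z. F z + G z)"
    using F G by (simp add: equivariant_on_def mat_conj_add)
  fix z assume z: "z \<in> PX"
  then show "sec_add X (Psi X P F) (Psi X P G) (pi0 z) = Psi X P (\<lambda>z. F z + G z) (pi0 z)"
    by (simp add: sec_add_def Psi_pi0[OF F] Psi_pi0[OF G] Psi_pi0[OF FG] fib_add_cls[OF PX_subset] pi0_in_X)
qed (simp_all add: sec_add_def Psi_extensional)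

lemma sec_mult_Psi:
  assumes F: "equivariant_on PX F" and G: "equivariant_on PX G"
  shows "sec_mult X (Psi X P F) (Psi X P G) = Psi X P (\<lambda>z. F z ** G z)"
proof (rule section_eqI)
  have FG: "equivariant_on PX (\<lambda>z. F z ** G z)"
    using F G by (simp add: equivariant_on_def mat_conj_mult unitary_invertible)
  fix z assume z: "z \<in> PX"
  then show "sec_mult X (Psi X P F) (Psi X P G) (pi0 z) = Psi X P (\<lambda>z. F z ** G z) (pi0 z)"
    by (simp add: sec_mult_def Psi_pi0[OF F] Psi_pi0[OF G] Psi_pi0[OF FG] fib_mult_cls[OF PX_subset] pi0_in_X)
qed (simp_all add: sec_mult_def Psi_extensional)

lemma sec_scale_Psi:
  assumes F: "equivariant_on PX F"
  shows "sec_scale X c (Psi X P F) = Psi X P (\<lambda>z. mat_scale c (F z))"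
proof (rule section_eqI)
  have cF: "equivariant_on PX (\<lambda>z. mat_scale c (F z))"
    using F by (simp add: equivariant_on_def mat_conj_scale)
  fix z assume z: "z \<in> PX"
  then show "sec_scale X c (Psi X P F) (pi0 z) = Psi X P (\<lambda>z. mat_scale c (F z)) (pi0 z)"
    by (simp add: sec_scale_def Psi_pi0[OF F] Psi_pi0[OF cF] fib_scale_cls[OF PX_subset] pi0_in_X)
qed (simp_all add: sec_scale_def Psi_extensional)

text \<open>Uniform approximability over \<open>X\<close> by elements of the trace algebra.\<close>

definition approximable :: "(('d, 'n) tuple \<Rightarrow> 'n cmat) \<Rightarrow> bool"
  where "approximable F \<longleftrightarrow> (\<forall>e>0. \<exists>\<phi>\<in>trace_algebra. \<forall>z\<in>PX. opnorm (F z - \<phi> z) < e)"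

text \<open>The norm closure of the trace algebra among the continuous sections over \<open>X\<close>. For \<open>X\<close> the Shilov
  boundary of a domain this is the tracial function algebra.\<close>

definition closure_trace_algebra :: "('d, 'n) bundle_section set"
  where "closure_trace_algebra = {\<sigma> \<in> Gamma_c X P. \<forall>e>0. \<exists>\<phi>\<in>trace_algebra.
    sup_norm fib_norm X (sec_add X \<sigma> (sec_scale X (-1) (Psi X P \<phi>))) < e}"

text \<open>Compactness makes the supremum a maximum, so that the strict inequality passes to it; \<open>X\<close> must not
  be empty, because the supremum of an empty set of reals is unspecified.\<close>

lemma sup_norm_Psi_diff_less_iff:
  assumes ne: "X \<noteq> {}" and F: "equivariant_on PX F" "continuous_on PX F" and \<phi>: "\<phi> \<in> trace_algebra"
  shows "sup_norm fib_norm X (sec_add X (Psi X P F) (sec_scale X (-1) (Psi X P \<phi>))) < e \<longleftrightarrow>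
    (\<forall>z\<in>PX. opnorm (F z - \<phi> z) < e)"
proof -
  note \<phi>e = trace_algebra_equivariant_on[OF \<phi>, of PX]
  have m: "equivariant_on PX (\<lambda>z. mat_scale (-1) (\<phi> z))"
    using \<phi>e by (simp add: equivariant_on_def mat_conj_scale)
  have d: "equivariant_on PX (\<lambda>z. F z + mat_scale (-1) (\<phi> z))"
    using F m by (simp add: equivariant_on_def mat_conj_add)
  have minus: "F z + mat_scale (-1) (\<phi> z) = F z - \<phi> z" for z
    by (simp add: vec_eq_iff)
  have "(\<lambda>u. fib_norm (sec_add X (Psi X P F) (sec_scale X (-1) (Psi X P \<phi>)) u)) ` X
      = (\<lambda>u. fib_norm (Psi X P (\<lambda>z. F z + mat_scale (-1) (\<phi> z)) u)) ` pi0 ` PX"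
    by (simp add: sec_scale_Psi[OF \<phi>e] sec_add_Psi[OF F(1) m] pi0_image_PX)
  also have "\<dots> = (\<lambda>z. opnorm (F z - \<phi> z)) ` PX"
    unfolding image_image
  proof (rule image_cong)
    fix z assume z: "z \<in> PX"
    show "fib_norm (Psi X P (\<lambda>z. F z + mat_scale (-1) (\<phi> z)) (pi0 z)) = opnorm (F z - \<phi> z)"
      by (subst Psi_pi0[OF d z], subst fib_norm_cls[OF PX_subset[OF z]], subst minus, rule refl)
  qed simp
  finally have im: "(\<lambda>u. fib_norm (sec_add X (Psi X P F) (sec_scale X (-1) (Psi X P \<phi>)) u)) ` X
      = (\<lambda>z. opnorm (F z - \<phi> z)) ` PX" .
  have "compact ((\<lambda>z. opnorm (F z - \<phi> z)) ` PX)"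
    using F(2) trace_algebra_continuous[OF \<phi>]
    by (intro compact_continuous_image compact_PX continuous_intros)
  moreover have "(\<lambda>z. opnorm (F z - \<phi> z)) ` PX \<noteq> {}" using ne pi0_image_PX by blast
  ultimately have "(SUP z\<in>PX. opnorm (F z - \<phi> z)) < e \<longleftrightarrow>
      (\<forall>x\<in>(\<lambda>z. opnorm (F z - \<phi> z)) ` PX. x < e)"
    by (rule Sup_compact_less_iff)
  then show ?thesis unfolding sup_norm_def im by (simp only: ball_simps)
qed

lemma Psi_in_closure_trace_algebra_iff:
  assumes "X \<noteq> {}" "equivariant_on PX F" "continuous_on PX F"
  shows "Psi X P F \<in> closure_trace_algebra \<longleftrightarrow> approximable F"
proof -
  have "(\<exists>\<phi>\<in>trace_algebra. sup_norm fib_norm X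
        (sec_add X (Psi X P F) (sec_scale X (-1) (Psi X P \<phi>))) < e) \<longleftrightarrow>
      (\<exists>\<phi>\<in>trace_algebra. \<forall>z\<in>PX. opnorm (F z - \<phi> z) < e)" for e
  proof (rule bex_cong[OF refl])
    fix \<phi> assume "\<phi> \<in> (trace_algebra :: (('d, 'n) tuple \<Rightarrow> 'n cmat) set)"
    then show "sup_norm fib_norm X (sec_add X (Psi X P F) (sec_scale X (-1) (Psi X P \<phi>))) < e \<longleftrightarrow>
        (\<forall>z\<in>PX. opnorm (F z - \<phi> z) < e)"
      by (rule sup_norm_Psi_diff_less_iff[OF assms])
  qed
  then show ?thesis
    using Psi_in_Gamma_c[OF assms(2,3)]
    unfolding closure_trace_algebra_def approximable_def by (simp only: mem_Collect_eq simp_thms)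
qed

lemma approximable_trace_algebra: "\<phi> \<in> trace_algebra \<Longrightarrow> approximable \<phi>"
  unfolding approximable_def by (auto intro!: bexI[of _ \<phi>])

lemma approximable_add:
  assumes "approximable F" "approximable G"
  shows "approximable (\<lambda>z. F z + G z)"
  unfolding approximable_def
proof (intro allI impI)
  fix e :: real assume "e > 0"
  then obtain \<phi> \<psi> where \<phi>: "\<phi> \<in> trace_algebra" "\<forall>z\<in>PX. opnorm (F z - \<phi> z) < e / 2"
    and \<psi>: "\<psi> \<in> trace_algebra" "\<forall>z\<in>PX. opnorm (G z - \<psi> z) < e / 2"
    using assms unfolding approximable_def by (meson half_gt_zero)
  have "opnorm (F z + G z - (\<phi> z + \<psi> z)) < e" if "z \<in> PX" for z
    using opnorm_triangle[of "F z - \<phi> z" "G z - \<psi> z"] \<phi>(2) \<psi>(2) that by (force simp: algebra_simps)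
  then show "\<exists>\<theta>\<in>trace_algebra. \<forall>z\<in>PX. opnorm (F z + G z - \<theta> z) < e"
    using trace_algebra_add[OF \<phi>(1) \<psi>(1)] by (intro bexI[of _ "\<lambda>z. \<phi> z + \<psi> z"]) auto
qed

lemma approximable_scale:
  assumes "approximable F"
  shows "approximable (\<lambda>z. mat_scale c (F z))"
  unfolding approximable_def
proof (intro allI impI)
  fix e :: real assume "e > 0"
  define \<delta> where "\<delta> = e / (norm c + 1)"
  have c: "norm c + 1 > 0" by (simp add: add_nonneg_pos)
  then have \<delta>: "\<delta> > 0" "\<delta> * (norm c + 1) = e" using \<open>e > 0\<close> by (simp_all add: \<delta>_def)
  obtain \<phi> where \<phi>: "\<phi> \<in> trace_algebra" "\<forall>z\<in>PX. opnorm (F z - \<phi> z) < \<delta>"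
    using assms \<delta>(1) unfolding approximable_def by blast
  have "opnorm (mat_scale c (F z) - mat_scale c (\<phi> z)) < e" if "z \<in> PX" for z
  proof -
    have "mat_scale c (F z) - mat_scale c (\<phi> z) = mat_scale c (F z - \<phi> z)"
      by (simp add: vec_eq_iff algebra_simps)
    then have "opnorm (mat_scale c (F z) - mat_scale c (\<phi> z)) \<le> norm c * opnorm (F z - \<phi> z)"
      using opnorm_scale by metis
    also have "\<dots> \<le> norm c * \<delta>"
      using \<phi>(2) that by (intro mult_left_mono) (auto intro: less_imp_le)
    also have "\<dots> < e" using \<delta> by (simp add: algebra_simps)
    finally show ?thesis .
  qed
  then show "\<exists>\<theta>\<in>trace_algebra. \<forall>z\<in>PX. opnorm (mat_scale c (F z) - \<theta> z) < e"
    using trace_algebra_scale[OF \<phi>(1)] by (intro bexI[of _ "\<lambda>z. mat_scale c (\<phi> z)"]) auto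
qed

lemma opnorm_bounded_on_PX:
  assumes "continuous_on PX F"
  shows "\<exists>M\<ge>0. \<forall>z\<in>PX. opnorm (F z) \<le> M"
proof -
  have "compact ((\<lambda>z. opnorm (F z)) ` PX)"
    using assms by (intro compact_continuous_image compact_PX continuous_intros)
  then have "bounded ((\<lambda>z. opnorm (F z)) ` PX)" by (rule compact_imp_bounded)
  then obtain M where "M > 0" "\<forall>z\<in>PX. \<bar>opnorm (F z)\<bar> \<le> M" unfolding bounded_pos by auto
  then show ?thesis by (intro exI[of _ M]) force
qed

lemma approximable_mult:
  assumes F: "approximable F" "continuous_on PX F" and G: "approximable G" "continuous_on PX G"
  shows "approximable (\<lambda>z. F z ** G z)"
  unfolding approximable_def
proof (intro allI impI)
  fix e :: real assume "e > 0"
  obtain M where M: "M \<ge> 0" "\<And>z. z \<in> PX \<Longrightarrow> opnorm (F z) \<le> M"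
    using opnorm_bounded_on_PX[OF F(2)] by blast
  obtain N where N: "N \<ge> 0" "\<And>z. z \<in> PX \<Longrightarrow> opnorm (G z) \<le> N"
    using opnorm_bounded_on_PX[OF G(2)] by blast
  define \<delta> where "\<delta> = min 1 (e / (M + N + 2))"
  have \<delta>: "\<delta> > 0" "\<delta> \<le> 1" using \<open>e > 0\<close> M(1) N(1) by (auto simp: \<delta>_def)
  have "\<delta> \<le> e / (M + N + 2)" by (simp add: \<delta>_def)
  then have "\<delta> * (M + N + 2) \<le> e" using M(1) N(1) by (simp add: pos_le_divide_eq)
  moreover have "\<delta> * (M + N + 1) < \<delta> * (M + N + 2)" using \<delta> by (intro mult_strict_left_mono) auto
  ultimately have small: "M * \<delta> + \<delta> * (N + 1) < e" by (simp add: algebra_simps)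
  obtain \<phi> \<psi> where \<phi>: "\<phi> \<in> trace_algebra" "\<forall>z\<in>PX. opnorm (F z - \<phi> z) < \<delta>"
    and \<psi>: "\<psi> \<in> trace_algebra" "\<forall>z\<in>PX. opnorm (G z - \<psi> z) < \<delta>"
    using F(1) G(1) \<delta>(1) unfolding approximable_def by meson
  have "opnorm (F z ** G z - \<phi> z ** \<psi> z) < e" if z: "z \<in> PX" for z
  proof -
    have "F z ** (G z - \<psi> z) + (F z - \<phi> z) ** \<psi> z = F z ** G z - \<phi> z ** \<psi> z"
      by (simp add: mat_mult_diff)
    then have "opnorm (F z ** G z - \<phi> z ** \<psi> z) \<le> opnorm (F z ** (G z - \<psi> z)) + opnorm ((F z - \<phi> z) ** \<psi> z)"
      using opnorm_triangle by metis
    also have "\<dots> \<le> opnorm (F z) * opnorm (G z - \<psi> z) + opnorm (F z - \<phi> z) * opnorm (\<psi> z)"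
      by (intro add_mono opnorm_mult)
    also have "\<dots> \<le> M * \<delta> + \<delta> * (N + 1)"
    proof (intro add_mono mult_mono opnorm_nonneg M N \<delta> less_imp_le[OF \<delta>(1)])
      show "opnorm (\<psi> z) \<le> N + 1"
        using opnorm_diff_le[of "G z" "\<psi> z"] N(2)[OF z] \<psi>(2) z \<delta>(2) by force
    qed (use \<phi> \<psi> z in \<open>auto intro: less_imp_le\<close>)
    finally show ?thesis using small by simp
  qed
  then show "\<exists>\<theta>\<in>trace_algebra. \<forall>z\<in>PX. opnorm (F z ** G z - \<theta> z) < e"
    using trace_algebra_mult[OF \<phi>(1) \<psi>(1)] by (intro bexI[of _ "\<lambda>z. \<phi> z ** \<psi> z"]) auto
qed

lemma section_subalgebra_closure_trace_algebra:
  assumes ne: "X \<noteq> {}"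
  shows "section_subalgebra X P closure_trace_algebra"
proof -
  let ?T = closure_trace_algebra
  have rep: "\<exists>F. equivariant_on PX F \<and> continuous_on PX F \<and> approximable F \<and> \<sigma> = Psi X P F"
    if "\<sigma> \<in> ?T" for \<sigma>
  proof -
    have "\<sigma> \<in> Gamma_c X P" using that by (simp add: closure_trace_algebra_def)
    then obtain F where F: "equivariant_on PX F" "continuous_on PX F" "\<sigma> = Psi X P F"
      by (rule Gamma_c_imp_Psi)
    then show ?thesis using that Psi_in_closure_trace_algebra_iff[OF ne F(1,2)] by blast
  qed
  note in_T = Psi_in_closure_trace_algebra_iff[OF ne, THEN iffD2]
  have "Psi X P (\<lambda>z. mat 1) \<in> ?T"
    by (intro in_T approximable_trace_algebra trace_algebra_1 trace_algebra_equivariant_on continuous_on_const)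
  moreover have "sec_add X \<sigma> \<tau> \<in> ?T \<and> sec_mult X \<sigma> \<tau> \<in> ?T" if \<sigma>\<tau>: "\<sigma> \<in> ?T" "\<tau> \<in> ?T" for \<sigma> \<tau>
  proof -
    obtain F where F: "equivariant_on PX F" "continuous_on PX F" "approximable F" "\<sigma> = Psi X P F"
      using rep[OF \<sigma>\<tau>(1)] by blast
    obtain G where G: "equivariant_on PX G" "continuous_on PX G" "approximable G" "\<tau> = Psi X P G"
      using rep[OF \<sigma>\<tau>(2)] by blast
    have eq: "equivariant_on PX (\<lambda>z. F z + G z)" "equivariant_on PX (\<lambda>z. F z ** G z)"
      using F(1) G(1) by (simp_all add: equivariant_on_def mat_conj_add mat_conj_mult unitary_invertible)
    show ?thesis
      unfolding F(4) G(4) sec_add_Psi[OF F(1) G(1)] sec_mult_Psi[OF F(1) G(1)]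
      using in_T[OF eq(1) continuous_on_add[OF F(2) G(2)] approximable_add[OF F(3) G(3)]]
        in_T[OF eq(2) continuous_on_mat_mult[OF F(2) G(2)] approximable_mult[OF F(3,2) G(3,2)]] ..
  qed
  moreover have "sec_scale X c \<sigma> \<in> ?T" if \<sigma>: "\<sigma> \<in> ?T" for c \<sigma>
  proof -
    obtain F where F: "equivariant_on PX F" "continuous_on PX F" "approximable F" "\<sigma> = Psi X P F"
      using rep[OF \<sigma>] by blast
    have "equivariant_on PX (\<lambda>z. mat_scale c (F z))"
      using F(1) by (simp add: equivariant_on_def mat_conj_scale)
    then show ?thesis
      unfolding F(4) sec_scale_Psi[OF F(1)]
      by (rule in_T[OF _ continuous_on_mat_scale[OF F(2) continuous_on_const] approximable_scale[OF F(3)]])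
  qed
  moreover have "?T \<subseteq> Gamma_c X P" by (auto simp: closure_trace_algebra_def)
  ultimately show ?thesis unfolding section_subalgebra_def unital_subalgebra_def by blast
qed

text \<open>If every section is a limit of the trace algebra, so is the scalar section \<open>cnj p\<close>. Normalised
  traces of the approximating matrices are invariants that approximate \<open>cnj p\<close> over \<open>X\<close>.\<close>

lemma invariants_approximate_cnj:
  assumes ne: "X \<noteq> {}" and eq: "closure_trace_algebra = Gamma_c X P"
    and p: "p \<in> invariants" and e: "e > 0"
  shows "\<exists>q\<in>invariants. \<forall>z\<in>PX. norm (q z - cnj (p z)) < e"
proof -
  define F where "F z = (mat (cnj (p z)) :: 'n cmat)" for z
  have F: "equivariant_on PX F"
    using p by (simp add: equivariant_on_def F_def invariants_def mat_conj_mat unitary_invertible)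
  have "continuous_on PX (\<lambda>z. mat_scale (cnj (p z)) (mat 1 :: 'n cmat))"
    using p by (intro continuous_intros polynomial_functions_continuous) (simp add: invariants_def)
  then have cont: "continuous_on PX F" by (simp add: F_def mat_scale_eq_mat_mult)
  have "Psi X P F \<in> closure_trace_algebra" using Psi_in_Gamma_c[OF F cont] eq by simp
  then obtain \<phi> where \<phi>: "\<phi> \<in> trace_algebra" "\<And>z. z \<in> PX \<Longrightarrow> opnorm (F z - \<phi> z) < e"
    using e unfolding Psi_in_closure_trace_algebra_iff[OF ne F cont] approximable_def by blast
  let ?n = "of_nat CARD('n) :: complex"
  have "norm (1 / ?n * trace (\<phi> z) - cnj (p z)) < e" if z: "z \<in> PX" for z
  proof -
    have "norm ((\<Sum>i\<in>UNIV. \<phi> z $ i $ i - cnj (p z))) \<le> (\<Sum>i\<in>(UNIV :: 'n set). opnorm (F z - \<phi> z))"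
    proof (rule order_trans[OF norm_sum], rule sum_mono)
      fix i
      have "\<phi> z $ i $ i - cnj (p z) = - ((F z - \<phi> z) $ i $ i)" by (simp add: F_def mat_def)
      then show "norm (\<phi> z $ i $ i - cnj (p z)) \<le> opnorm (F z - \<phi> z)"
        using norm_nth_le_opnorm by (metis norm_minus_cancel)
    qed
    moreover have "(\<Sum>i\<in>UNIV. \<phi> z $ i $ i - cnj (p z)) = ?n * (1 / ?n * trace (\<phi> z) - cnj (p z))"
      by (simp add: trace_def sum_subtractf algebra_simps)
    ultimately have "CARD('n) * norm (1 / ?n * trace (\<phi> z) - cnj (p z)) \<le> CARD('n) * opnorm (F z - \<phi> z)"
      by (simp add: norm_mult)
    then have "norm (1 / ?n * trace (\<phi> z) - cnj (p z)) \<le> opnorm (F z - \<phi> z)" by simp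
    then show ?thesis using \<phi>(2)[OF z] by simp
  qed
  then show ?thesis
    using invariants_scale[OF trace_algebra_trace[OF \<phi>(1)], of "1 / ?n"]
    by (intro bexI[of _ "\<lambda>z. 1 / ?n * trace (\<phi> z)"]) auto
qed

end

section \<open>The maximum principle and conjugates of invariants\<close>

lemma
  assumes "\<xi> \<in> Q_space"
  shows Q_space_one: "\<xi> (\<lambda>z. 1) = 1"
    and Q_space_add: "p \<in> invariants \<Longrightarrow> q \<in> invariants \<Longrightarrow> \<xi> (\<lambda>z. p z + q z) = \<xi> p + \<xi> q"
    and Q_space_mult: "p \<in> invariants \<Longrightarrow> q \<in> invariants \<Longrightarrow> \<xi> (\<lambda>z. p z * q z) = \<xi> p * \<xi> q"
    and Q_space_scale: "p \<in> invariants \<Longrightarrow> \<xi> (\<lambda>z. c * p z) = c * \<xi> p"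
  using assms by (simp_all add: Q_space_def)

lemma Q_space_const: "\<xi> \<in> Q_space \<Longrightarrow> \<xi> (\<lambda>z. c) = c"
  using Q_space_scale[of \<xi> "\<lambda>z. 1" c] by (simp add: invariants_const Q_space_one)

lemma topspace_Q_top: "topspace Q_top = Q_space"
  by (auto simp: Q_top_def Q_space_def PiE_def)

lemma continuous_map_eval:
  assumes "p \<in> invariants"
  shows "continuous_map Q_top euclidean (\<lambda>\<xi>. \<xi> p)"
  using continuous_map_product_coordinates[OF assms, of "\<lambda>_. euclidean :: complex topology"]
  unfolding Q_top_def by (rule continuous_map_from_subtopology)

lemma pi0_apply: "p \<in> invariants \<Longrightarrow> pi0 z p = p z"
  by (simp add: pi0_def)

lemma pi0_in_Q_space: "pi0 z \<in> Q_space"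
  by (simp add: Q_space_def pi0_def invariants_const invariants_add invariants_mult invariants_scale)

lemma continuous_map_pi0: "continuous_map euclidean Q_top pi0"
proof -
  have "continuous_map euclidean euclidean (\<lambda>z. pi0 z p)" if "p \<in> invariants" for p
    using that polynomial_functions_continuous[of p UNIV] by (simp add: pi0_apply invariants_def)
  then have "continuous_map euclidean (product_topology (\<lambda>_. euclidean) invariants) pi0"
    unfolding continuous_map_componentwise using Q_space_def pi0_in_Q_space by fast
  then show ?thesis
    unfolding Q_top_def by (rule continuous_map_into_subtopology) (simp add: pi0_in_Q_space)
qed

text \<open>Every neighbourhood of a point of the spectrum contains a polyhedron about that point which is
  defined by finitely many invariants.\<close>

lemma Q_top_polyhedral_base:
  assumes W: "openin Q_top W" and x: "x \<in> W"
  obtains J where "finite J" "J \<subseteq> invariants" "\<forall>p\<in>J. norm (x p) < 1"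
    "{y \<in> Q_space. \<forall>p\<in>J. norm (y p) < 1} \<subseteq> W"
proof -
  obtain W' where W': "openin (product_topology (\<lambda>_. euclidean) invariants) W'" "W = W' \<inter> Q_space"
    using W by (auto simp: Q_top_def openin_subtopology)
  have xQ: "x \<in> Q_space" using x W' by blast
  have "x \<in> W'" using x W'(2) by blast
  then have "\<exists>U. finite {p \<in> invariants. U p \<noteq> topspace (euclidean :: complex topology)} \<and>
      (\<forall>p\<in>invariants. openin euclidean (U p)) \<and> x \<in> Pi\<^sub>E invariants U \<and> Pi\<^sub>E invariants U \<subseteq> W'"
    by (rule W'(1)[unfolded openin_product_topology_alt, rule_format])
  then obtain U where U: "finite {p \<in> invariants. U p \<noteq> (UNIV :: complex set)}" "\<And>p. p \<in> invariants \<Longrightarrow> open (U p)"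
     "x \<in> Pi\<^sub>E invariants U" "Pi\<^sub>E invariants U \<subseteq> W'"
    unfolding topspace_euclidean open_openin[symmetric] by blast
  define I where "I = {p \<in> invariants. U p \<noteq> (UNIV :: complex set)}"
  have "\<exists>r>0. ball (x p) r \<subseteq> U p" if "p \<in> I" for p
  proof -
    have p: "p \<in> invariants" using that by (simp add: I_def)
    show ?thesis using U(2)[OF p] PiE_mem[OF U(3) p] open_contains_ball by blast
  qed
  then obtain r where r: "\<And>p. p \<in> I \<Longrightarrow> r p > 0" "\<And>p. p \<in> I \<Longrightarrow> ball (x p) (r p) \<subseteq> U p"
    by metis
  define g where "g p = (\<lambda>z. complex_of_real (1 / r p) * (p z + - x p))" for p
  have g: "g p \<in> invariants" if "p \<in> I" for p
    unfolding g_def using that by (intro invariants_scale invariants_add invariants_const) (simp add: I_def)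
  have eval: "y (g p) = complex_of_real (1 / r p) * (y p - x p)" if "p \<in> I" "y \<in> Q_space" for p y
  proof -
    have p: "p \<in> invariants" using that by (simp add: I_def)
    have "y (g p) = complex_of_real (1 / r p) * (y (\<lambda>z. p z + - x p))"
      unfolding g_def by (rule Q_space_scale[OF that(2) invariants_add[OF p invariants_const]])
    also have "y (\<lambda>z. p z + - x p) = y p + - x p"
      unfolding Q_space_add[OF that(2) p invariants_const] Q_space_const[OF that(2)] ..
    finally show ?thesis by simp
  qed
  show ?thesis
  proof (rule that[of "g ` I"])
    show "finite (g ` I)" using U(1) by (simp add: I_def)
    show "g ` I \<subseteq> invariants" using g by blast
    show "\<forall>p\<in>g ` I. norm (x p) < 1" by (auto simp: eval xQ)
    show "{y \<in> Q_space. \<forall>p\<in>g ` I. norm (y p) < 1} \<subseteq> W"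
    proof clarify
      fix y assume y: "y \<in> Q_space" "\<forall>p\<in>g ` I. norm (y p) < 1"
      have "y p \<in> U p" if "p \<in> invariants" for p
      proof (cases "p \<in> I")
        case True
        have "y p - x p = of_real (r p) * y (g p)"
          using r(1)[OF True] by (simp add: eval[OF True y(1)])
        moreover have "norm (y (g p)) < 1" using y(2) True by blast
        ultimately have "norm (y p - x p) < r p"
          using r(1)[OF True] by (simp add: norm_mult)
        then show ?thesis using r(2)[OF True] by (auto simp: dist_norm norm_minus_commute)
      qed (use that in \<open>auto simp: I_def\<close>)
      moreover have "y \<in> extensional invariants" using y(1) by (simp add: Q_space_def)
      ultimately have "y \<in> Pi\<^sub>E invariants U" by (simp add: PiE_iff)
      then show "y \<in> W" using U(4) W'(2) y(1) by blast
    qed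
  qed
qed

lemma restrict_eval_in_invariant_function_algebra:
  assumes p: "p \<in> invariants" and ne: "Q_top closure_of D \<noteq> {}"
  shows "(\<lambda>\<xi>\<in>Q_top closure_of D. \<xi> p) \<in> invariant_function_algebra D"
  unfolding invariant_function_algebra_def Let_def
proof (intro CollectI conjI allI impI)
  let ?C = "Q_top closure_of D"
  show "continuous_map (subtopology Q_top ?C) euclidean (\<lambda>\<xi>\<in>?C. \<xi> p)"
    by (rule continuous_map_eq[OF continuous_map_from_subtopology[OF continuous_map_eval[OF p]]]) simp
  fix e :: real assume "e > 0"
  have "sup_norm norm ?C (\<lambda>\<xi>. (\<lambda>\<xi>\<in>?C. \<xi> p) \<xi> - \<xi> p) = (SUP \<xi>\<in>?C. 0)"
    unfolding sup_norm_def by (rule SUP_cong) auto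
  then have "sup_norm norm ?C (\<lambda>\<xi>. (\<lambda>\<xi>\<in>?C. \<xi> p) \<xi> - \<xi> p) < e"
    using ne \<open>e > 0\<close> by simp
  then show "\<exists>q\<in>invariants. sup_norm norm ?C (\<lambda>\<xi>. (\<lambda>\<xi>\<in>?C. \<xi> p) \<xi> - \<xi> q) < e"
    using p by blast
qed simp

text \<open>The maximum principle for invariants. The invariants themselves, without passing to the uniform
  closure, already satisfy the hypotheses for the existence of the Shilov boundary, and every closed
  boundary of the closure is one for them; hence their Shilov boundary lies in \<open>bdry D\<close>.\<close>

lemma invariant_attains_max_on_bdry:
  fixes D :: "('d::finite, 'n::finite) qpoint set"
  assumes comp: "compactin Q_top (Q_top closure_of D)" and ne: "Q_top closure_of D \<noteq> {}"
    and p: "p \<in> invariants"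
  shows "\<exists>x\<in>bdry D. \<forall>y\<in>Q_top closure_of D. norm (y p) \<le> norm (x p)"
proof -
  define C where "C = Q_top closure_of D"
  define T where "T = subtopology Q_top C"
  define A where "A = {\<lambda>\<xi> :: ('d, 'n) qpoint. \<xi> q | q. q \<in> invariants}"
  have CQ: "C \<subseteq> Q_space" unfolding C_def topspace_Q_top[symmetric] by (rule closure_of_subset_topspace)
  have topT: "topspace T = C" using CQ by (auto simp: T_def topspace_Q_top)
  have "closed_boundary T A (shilov_boundary T A)"
  proof (rule closed_boundary_shilov_boundary)
    show "compact_space T" unfolding T_def C_def by (rule compact_space_subtopology[OF comp])
    show "topspace T \<noteq> {}" using ne by (simp add: topT C_def)
    show "continuous_map T euclidean f" if "f \<in> A" for f
      using that unfolding T_def A_def by (auto intro: continuous_map_from_subtopology continuous_map_eval)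
    show "\<exists>h\<in>A. \<forall>x\<in>topspace T. h x = f x * g x" if fg: "f \<in> A" "g \<in> A" for f g
    proof -
      obtain q r where q: "q \<in> invariants" "f = (\<lambda>\<xi>. \<xi> q)" and r: "r \<in> invariants" "g = (\<lambda>\<xi>. \<xi> r)"
        using fg by (auto simp: A_def)
      have "(\<lambda>\<xi>. \<xi> (\<lambda>z. q z * r z)) \<in> A" using invariants_mult[OF q(1) r(1)] by (auto simp: A_def)
      moreover have "\<forall>x\<in>topspace T. x (\<lambda>z. q z * r z) = f x * g x"
        using Q_space_mult[OF _ q(1) r(1)] CQ by (auto simp: q(2) r(2) topT)
      ultimately show ?thesis by (intro bexI)
    qed
    show "\<exists>F\<subseteq>A. finite F \<and> (\<forall>f\<in>F. norm (f x) < 1) \<and> {y \<in> topspace T. \<forall>f\<in>F. norm (f y) < 1} \<subseteq> U"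
      if U: "openin T U" "x \<in> U" for U x
    proof -
      obtain W where W: "openin Q_top W" "U = W \<inter> C" using U(1) by (auto simp: T_def openin_subtopology)
      then obtain J where J: "finite J" "J \<subseteq> invariants" "\<forall>p\<in>J. norm (x p) < 1"
          "{y \<in> Q_space. \<forall>p\<in>J. norm (y p) < 1} \<subseteq> W"
        using Q_top_polyhedral_base[of W x] U(2) by blast
      show ?thesis
      proof (intro exI conjI)
        show "(\<lambda>q \<xi>. \<xi> q) ` J \<subseteq> A" using J(2) by (auto simp: A_def)
        show "{y \<in> topspace T. \<forall>f\<in>(\<lambda>q \<xi>. \<xi> q) ` J. norm (f y) < 1} \<subseteq> U"
          using J(4) CQ by (auto simp: topT W(2))
      qed (use J in auto)
    qed
  qed
  then obtain x where x: "x \<in> shilov_boundary T A" "\<forall>y\<in>topspace T. norm (y p) \<le> norm (x p)"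
    using p unfolding closed_boundary_def A_def by auto
  have "closed_boundary T A B" if B: "closed_boundary T (invariant_function_algebra D) B" for B
    unfolding closed_boundary_def
  proof (intro conjI ballI)
    show clB: "closedin T B" using B by (simp add: closed_boundary_def)
    then have "B \<subseteq> C" using closedin_subset topT by metis
    fix f assume "f \<in> A"
    then obtain q where q: "q \<in> invariants" "f = (\<lambda>\<xi>. \<xi> q)" by (auto simp: A_def)
    then obtain b where "b \<in> B" "\<forall>y\<in>C. norm ((\<lambda>\<xi>\<in>C. \<xi> q) y) \<le> norm ((\<lambda>\<xi>\<in>C. \<xi> q) b)"
      using B restrict_eval_in_invariant_function_algebra[OF q(1) ne]
      unfolding closed_boundary_def topT C_def by blast
    then show "\<exists>x\<in>B. \<forall>y\<in>topspace T. norm (f y) \<le> norm (f x)"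
      using \<open>B \<subseteq> C\<close> by (intro bexI[of _ b]) (auto simp: topT q(2))
  qed
  then have "shilov_boundary T A \<subseteq> bdry D"
    unfolding bdry_def C_def[symmetric] T_def[symmetric] by (auto simp: shilov_boundary_def)
  then show ?thesis using x unfolding topT C_def by blast
qed

text \<open>The quadratic terms in \<open>t\<close> cancel, and the linear ones give the conclusion as \<open>t\<close> grows.\<close>

lemma le_of_shifted_squares_le:
  fixes v e M :: real
  assumes "e \<ge> 0" and "\<And>t. t \<ge> 0 \<Longrightarrow> (v + t)\<^sup>2 \<le> M\<^sup>2 + (e + t)\<^sup>2"
  shows "v \<le> e"
proof (rule ccontr)
  assume "\<not> v \<le> e"
  define t where "t = (M\<^sup>2 + e\<^sup>2) / (v - e)"
  have t: "t \<ge> 0" "t * (v - e) = M\<^sup>2 + e\<^sup>2" using \<open>\<not> v \<le> e\<close> by (auto simp: t_def)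
  have "v\<^sup>2 + 2 * (t * (v - e)) \<le> M\<^sup>2 + e\<^sup>2"
    using assms(2)[OF t(1)] by (simp add: power2_eq_square algebra_simps)
  then have "v\<^sup>2 \<le> 0" unfolding t(2) by (smt (verit) zero_le_power2)
  then show False using \<open>\<not> v \<le> e\<close> assms(1) by simp
qed

text \<open>The maximum principle extends from moduli to imaginary parts, by applying it to \<open>f + \<i> t\<close> for all
  \<open>t \<ge> 0\<close>.\<close>

lemma Im_invariant_le:
  assumes CQ: "C \<subseteq> Q_space" and XC: "X \<subseteq> C"
    and max: "\<And>p. p \<in> invariants \<Longrightarrow> \<exists>x\<in>X. \<forall>y\<in>C. norm (y p) \<le> norm (x p)"
    and f: "f \<in> invariants" and e: "e \<ge> 0" "\<And>x. x \<in> X \<Longrightarrow> \<bar>Im (x f)\<bar> \<le> e" and y: "y \<in> C"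
  shows "Im (y f) \<le> e"
proof -
  obtain x0 where x0: "x0 \<in> X" "\<And>y. y \<in> C \<Longrightarrow> norm (y f) \<le> norm (x0 f)"
    using max[OF f] by blast
  show ?thesis
  proof (rule le_of_shifted_squares_le[where M = "norm (x0 f)", OF e(1)])
    fix t :: real assume t: "t \<ge> 0"
    have shift: "w (\<lambda>z. f z + \<i> * of_real t) = w f + \<i> * of_real t" if "w \<in> C" for w
      using Q_space_add[OF _ f invariants_const, of w] Q_space_const[of w] that CQ by auto
    obtain x where x: "x \<in> X" "norm (y f + \<i> * of_real t) \<le> norm (x f + \<i> * of_real t)"
      using max[OF invariants_add[OF f invariants_const], of "\<i> * of_real t"] y XC shift by fastforce
    have "(Im (y f) + t)\<^sup>2 \<le> (norm (y f + \<i> * of_real t))\<^sup>2"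
      by (simp add: cmod_power2)
    also have "\<dots> \<le> (norm (x f + \<i> * of_real t))\<^sup>2"
      using x(2) by (rule power_mono) simp
    also have "\<dots> = (Re (x f))\<^sup>2 + (Im (x f) + t)\<^sup>2" by (simp add: cmod_power2)
    also have "\<dots> \<le> (norm (x0 f))\<^sup>2 + (e + t)\<^sup>2"
    proof (rule add_mono)
      have "\<bar>Re (x f)\<bar> \<le> norm (x0 f)"
        using abs_Re_le_cmod[of "x f"] x0(2)[of x] x(1) XC by force
      then show "(Re (x f))\<^sup>2 \<le> (norm (x0 f))\<^sup>2" by (metis power2_abs power_mono abs_ge_zero)
      have "\<bar>Im (x f) + t\<bar> \<le> e + t" using e(2)[OF x(1)] t by linarith
      then show "(Im (x f) + t)\<^sup>2 \<le> (e + t)\<^sup>2" by (metis power2_abs power_mono abs_ge_zero)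
    qed
    finally show "(Im (y f) + t)\<^sup>2 \<le> (norm (x0 f))\<^sup>2 + (e + t)\<^sup>2" .
  qed
qed

lemma abs_Im_invariant_le:
  assumes CQ: "C \<subseteq> Q_space" and XC: "X \<subseteq> C"
    and max: "\<And>p. p \<in> invariants \<Longrightarrow> \<exists>x\<in>X. \<forall>y\<in>C. norm (y p) \<le> norm (x p)"
    and f: "f \<in> invariants" and e: "e \<ge> 0" "\<And>x. x \<in> X \<Longrightarrow> \<bar>Im (x f)\<bar> \<le> e" and y: "y \<in> C"
  shows "\<bar>Im (y f)\<bar> \<le> e"
proof -
  have m: "w (\<lambda>z. -1 * f z) = - w f" if "w \<in> C" for w
    using Q_space_scale[OF _ f, of w "-1"] that CQ by auto
  have "Im (y (\<lambda>z. -1 * f z)) \<le> e"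
  proof (rule Im_invariant_le[OF CQ XC max invariants_scale[OF f] e(1) _ y])
    fix x assume x: "x \<in> X"
    then have "x \<in> C" using XC by blast
    show "\<bar>Im (x (\<lambda>z. -1 * f z))\<bar> \<le> e"
      unfolding m[OF \<open>x \<in> C\<close>] using e(2)[OF x] by simp
  qed
  moreover have "Im (y f) \<le> e"
    by (rule Im_invariant_le[OF CQ XC max f e(1) _ y]) (assumption | erule e(2))+
  ultimately show ?thesis unfolding m[OF y] by simp
qed

text \<open>An approximation of \<open>cnj p\<close> by an invariant \<open>q\<close> on \<open>X\<close> persists on \<open>C\<close>, although \<open>cnj p\<close> is not an
  invariant: the real and the imaginary part of \<open>q - cnj p\<close> are the imaginary parts of the invariants
  \<open>\<i> (q - p)\<close> and \<open>q + p\<close>.\<close>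

lemma approximate_cnj_extends:
  assumes CQ: "C \<subseteq> Q_space" and XC: "X \<subseteq> C"
    and max: "\<And>p. p \<in> invariants \<Longrightarrow> \<exists>x\<in>X. \<forall>y\<in>C. norm (y p) \<le> norm (x p)"
    and p: "p \<in> invariants" and q: "q \<in> invariants"
    and e: "e \<ge> 0" "\<And>x. x \<in> X \<Longrightarrow> norm (x q - cnj (x p)) \<le> e" and y: "y \<in> C"
  shows "norm (y q - cnj (y p)) \<le> 2 * e"
proof -
  let ?f = "\<lambda>z. q z + p z" and ?g = "\<lambda>z. \<i> * (q z + -1 * p z)"
  have inv: "?f \<in> invariants" "?g \<in> invariants"
    by (rule invariants_add[OF q p], rule invariants_scale[OF invariants_add[OF q invariants_scale[OF p]]])
  have f: "w ?f = w q + w p" and g: "w ?g = \<i> * (w q - w p)" if "w \<in> C" for w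
  proof -
    have w: "w \<in> Q_space" using that CQ by blast
    show "w ?f = w q + w p" by (rule Q_space_add[OF w q p])
    show "w ?g = \<i> * (w q - w p)"
      using Q_space_scale[OF w invariants_add[OF q invariants_scale[OF p]], of \<i> "-1"]
        Q_space_add[OF w q invariants_scale[OF p], of "-1"] Q_space_scale[OF w p, of "-1"] by simp
  qed
  have "\<bar>Im (y ?f)\<bar> \<le> e"
  proof (rule abs_Im_invariant_le[OF CQ XC max inv(1) e(1) _ y])
    fix x assume x: "x \<in> X"
    then have "x \<in> C" using XC by blast
    have "Im (x ?f) = Im (x q - cnj (x p))" unfolding f[OF \<open>x \<in> C\<close>] by simp
    then show "\<bar>Im (x ?f)\<bar> \<le> e" using abs_Im_le_cmod e(2)[OF x] by (metis order_trans)
  qed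
  moreover have "\<bar>Im (y ?g)\<bar> \<le> e"
  proof (rule abs_Im_invariant_le[OF CQ XC max inv(2) e(1) _ y])
    fix x assume x: "x \<in> X"
    then have "x \<in> C" using XC by blast
    have "Im (x ?g) = Re (x q - cnj (x p))" unfolding g[OF \<open>x \<in> C\<close>] by simp
    then show "\<bar>Im (x ?g)\<bar> \<le> e" using abs_Re_le_cmod e(2)[OF x] by (metis order_trans)
  qed
  moreover have "norm (y q - cnj (y p)) \<le> \<bar>Re (y q - cnj (y p))\<bar> + \<bar>Im (y q - cnj (y p))\<bar>"
    by (rule cmod_le)
  ultimately show ?thesis unfolding f[OF y] g[OF y] by simp
qed

text \<open>The complex line through a tuple in the direction of the tuple of identity matrices. It consists
  of generating tuples whenever the given tuple is generating.\<close>

definition scalar_line :: "('d::finite, 'n::finite) tuple \<Rightarrow> complex \<Rightarrow> ('d, 'n) tuple"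
  where "scalar_line z \<zeta> = z + (\<chi> i. mat_scale \<zeta> (mat 1))"

lemma scalar_line_generating:
  assumes "z \<in> generating_tuples"
  shows "scalar_line z \<zeta> \<in> generating_tuples"
proof -
  let ?H = "mat_subalgebra hull (range (\<lambda>i. scalar_line z \<zeta> $ i))"
  have H: "mat_subalgebra ?H" unfolding mat_subalgebra_def by (rule unital_subalgebra_hull)
  have "z $ i \<in> ?H" for i
  proof -
    have "scalar_line z \<zeta> $ i \<in> ?H" by (rule hull_inc) simp
    moreover have "mat_scale (- \<zeta>) (mat 1) \<in> ?H"
      using H by (auto simp: mat_subalgebra_def unital_subalgebra_def)
    ultimately have "scalar_line z \<zeta> $ i + mat_scale (- \<zeta>) (mat 1) \<in> ?H"
      using H by (auto simp: mat_subalgebra_def unital_subalgebra_def)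
    moreover have "scalar_line z \<zeta> $ i + mat_scale (- \<zeta>) (mat 1) = z $ i"
      by (simp add: scalar_line_def vec_eq_iff)
    ultimately show ?thesis by simp
  qed
  then have "mat_subalgebra hull (range (\<lambda>i. z $ i)) \<subseteq> ?H"
    using H by (intro hull_minimal) auto
  then show ?thesis using assms by (auto simp: generating_tuples_def)
qed

lemma continuous_on_scalar_line: "continuous_on S (scalar_line z)"
  unfolding scalar_line_def by (intro continuous_intros)

lemma trace_scalar_line:
  "trace (scalar_line z \<zeta> $ i) = trace (z $ i) + of_nat CARD('n) * \<zeta>" for z :: "('d::finite, 'n::finite) tuple"
  by (simp add: trace_def scalar_line_def mat_def sum.distrib)

text \<open>On the circle of radius \<open>r\<close> the function \<open>\<zeta> f(\<zeta>) - c r\<^sup>2\<close> has modulus \<open>r\<close> times the distance from \<open>f\<close> to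
  \<open>c \<cdot> cnj \<zeta>\<close>, while at the centre its modulus is \<open>c r\<^sup>2\<close>; the maximum modulus principle
  compares the two.\<close>

lemma cnj_not_approximable_by_holomorphic:
  assumes r: "r > 0" and c: "c > 0" and hol: "f holomorphic_on cball 0 r"
  shows "\<exists>\<zeta>. norm \<zeta> = r \<and> c * r \<le> norm (f \<zeta> - of_real c * cnj \<zeta>)"
proof (rule ccontr)
  assume "\<not> ?thesis"
  then have "\<forall>\<zeta>. norm \<zeta> = r \<longrightarrow> norm (f \<zeta> - of_real c * cnj \<zeta>) < c * r"
    by (simp add: not_le)
  then have less: "norm (f \<zeta> - of_real c * cnj \<zeta>) < c * r" if "norm \<zeta> = r" for \<zeta>
    using that by blast
  define g where "g \<zeta> = \<zeta> * f \<zeta> - of_real (c * r\<^sup>2)" for \<zeta>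
  have g_eq: "g \<zeta> = \<zeta> * (f \<zeta> - of_real c * cnj \<zeta>)" if "norm \<zeta> = r" for \<zeta>
    using complex_norm_square[of \<zeta>] that by (simp add: g_def algebra_simps)
  have hg: "g holomorphic_on cball 0 r" unfolding g_def by (intro holomorphic_intros hol)
  define h where "h = (\<lambda>\<zeta>. norm (g \<zeta>))"
  have "continuous_on (sphere 0 r) h"
    unfolding h_def using holomorphic_on_imp_continuous_on[OF hg]
    by (intro continuous_on_norm) (auto intro: continuous_on_subset)
  then obtain \<zeta>0 where z0: "\<zeta>0 \<in> sphere 0 r" "\<And>\<zeta>. \<zeta> \<in> sphere 0 r \<Longrightarrow> h \<zeta> \<le> h \<zeta>0"
    using continuous_attains_sup[of "sphere 0 r" h] r by auto
  have "norm (g 0) \<le> h \<zeta>0"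
  proof (rule maximum_modulus_frontier[of g "cball 0 r"])
    show "g holomorphic_on interior (cball 0 r)" using hg by (rule holomorphic_on_subset) auto
    show "continuous_on (closure (cball 0 r)) g" using holomorphic_on_imp_continuous_on[OF hg] by simp
    show "norm (g \<zeta>) \<le> h \<zeta>0" if "\<zeta> \<in> frontier (cball 0 r)" for \<zeta>
      using z0(2)[of \<zeta>] that by (simp add: h_def frontier_cball)
  qed (use r in auto)
  moreover have "norm (g 0) = c * r\<^sup>2" using c by (simp add: g_def norm_mult norm_power)
  moreover have "h \<zeta>0 < r * (c * r)"
    using z0(1) less[of \<zeta>0] r g_eq[of \<zeta>0] by (simp add: h_def norm_mult)
  ultimately show False by (simp add: power2_eq_square mult_ac)
qed

lemma domain_contains_scalar_disc:
  assumes D: "Q0_domain D"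
  obtains z r where "z \<in> generating_tuples" "r > 0" "\<And>\<zeta>. norm \<zeta> \<le> r \<Longrightarrow> pi0 (scalar_line z \<zeta>) \<in> D"
proof -
  obtain W where W: "openin Q_top W" "D = W \<inter> Q0_space"
    using D by (auto simp: Q0_domain_def openin_subtopology)
  obtain z where z: "z \<in> generating_tuples" "pi0 z \<in> W"
    using D W(2) by (auto simp: Q0_domain_def Q0_space_def)
  have "open {w. pi0 w \<in> W}"
    using openin_continuous_map_preimage[OF continuous_map_pi0 W(1)] by simp
  then have "open (scalar_line z -` {w. pi0 w \<in> W})"
    using continuous_on_scalar_line[of UNIV z] by (intro open_vimage) auto
  moreover have "scalar_line z 0 = z" by (simp add: scalar_line_def vec_eq_iff)
  then have "0 \<in> scalar_line z -` {w. pi0 w \<in> W}" using z(2) by simp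
  ultimately obtain r where r: "r > 0" "cball 0 r \<subseteq> scalar_line z -` {w. pi0 w \<in> W}"
    by (rule open_contains_cball[THEN iffD1, THEN bspec, THEN exE]) blast
  show ?thesis
  proof (rule that[OF z(1) r(1)])
    fix \<zeta> :: complex assume "norm \<zeta> \<le> r"
    then have "pi0 (scalar_line z \<zeta>) \<in> W" using r(2) by auto
    moreover have "pi0 (scalar_line z \<zeta>) \<in> Q0_space"
      unfolding Q0_space_def using scalar_line_generating[OF z(1)] by blast
    ultimately show "pi0 (scalar_line z \<zeta>) \<in> D" using W(2) by blast
  qed
qed

section \<open>Properness of the tracial function algebra\<close>

theorem corollary3p2:
  fixes D :: "('d::finite, 'n::finite) qpoint set" and P :: "('d, 'n) tuple set"
  assumes "CARD('d) \<ge> 2" and "CARD('n) \<ge> 2"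
    and "Q0_domain D"
    and "compactin Q_top (Q_top closure_of D)" and "Q_top closure_of D \<subseteq> Q0_space"
    and "reduction D P"
  shows "section_subalgebra (bdry D) P (tracial_function_algebra D P) \<and>
    tracial_function_algebra D P \<noteq> Gamma_c (bdry D) P"
proof -
  define C where "C = Q_top closure_of D"
  have C_top: "C \<subseteq> topspace Q_top" unfolding C_def by (rule closure_of_subset_topspace)
  then have CQ: "C \<subseteq> Q_space" by (simp add: topspace_Q_top)
  have "D \<subseteq> topspace Q_top"
    using assms(3) by (auto simp: Q0_domain_def connectedin_def)
  then have DC: "D \<subseteq> C" unfolding C_def by (rule closure_of_subset)
  have Cne: "C \<noteq> {}" using DC assms(3) by (auto simp: Q0_domain_def)
  interpret unitary_reduction C "bdry D" P
  proof
    show "closedin (subtopology Q_top C) (bdry D)"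
      unfolding bdry_def C_def by (rule closedin_shilov_boundary)
  qed (use assms(6) C_top in \<open>auto simp: reduction_def C_def\<close>)
  have max: "\<exists>x\<in>bdry D. \<forall>y\<in>C. norm (y p) \<le> norm (x p)" if "p \<in> invariants" for p
    using invariant_attains_max_on_bdry[OF assms(4) _ that] Cne unfolding C_def by blast
  have bdry_ne: "bdry D \<noteq> {}" using max[OF invariants_const] by blast
  have T: "tracial_function_algebra D P = closure_trace_algebra"
    by (simp add: tracial_function_algebra_def closure_trace_algebra_def)
  have "closure_trace_algebra \<noteq> Gamma_c (bdry D) P"
  proof
    assume eq: "closure_trace_algebra = Gamma_c (bdry D) P"
    obtain z r where z: "r > 0" "\<And>\<zeta>. norm \<zeta> \<le> r \<Longrightarrow> pi0 (scalar_line z \<zeta>) \<in> D"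
      using domain_contains_scalar_disc[OF assms(3)] by metis
    define i where "i = (undefined :: 'd)"
    define p where "p = (\<lambda>w :: ('d, 'n) tuple. trace (w $ i))"
    have p: "p \<in> invariants" unfolding p_def by (rule trace_algebra_trace[OF trace_algebra_coordinate])
    define n where "n = real CARD('n)"
    have n: "n > 0" by (simp add: n_def)
    \<comment> \<open>The loss of a factor 2 in the extension to \<open>C\<close> still leaves \<open>2 * e < n * r\<close>.\<close>
    define e where "e = n * r / 4"
    have e: "e > 0" using n z(1) by (simp add: e_def)
    obtain q where q: "q \<in> invariants" "\<And>w. w \<in> PX \<Longrightarrow> norm (q w - cnj (p w)) < e"
      using invariants_approximate_cnj[OF bdry_ne eq p e] by blast
    have bound: "norm (x q - cnj (x p)) \<le> e" if x: "x \<in> bdry D" for x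
    proof -
      obtain w where w: "w \<in> PX" "x = pi0 w" using X_eq_pi0[OF x] by blast
      then have "x q - cnj (x p) = q w - cnj (p w)" by (simp only: pi0_apply p q(1))
      then show ?thesis using q(2)[OF w(1)] by simp
    qed
    have close: "norm (y q - cnj (y p)) \<le> 2 * e" if "y \<in> C" for y
      by (rule approximate_cnj_extends[OF CQ X_subset_C max p q(1) less_imp_le[OF e] _ that])
        (assumption | erule bound)+
    define f where "f \<zeta> = q (scalar_line z \<zeta>) - cnj (p z)" for \<zeta>
    have "(\<lambda>\<zeta>. q (z + (\<chi> i. mat_scale \<zeta> ((\<chi> i. mat 1) $ i)))) holomorphic_on cball 0 r"
      using q(1) by (intro polynomial_functions_holomorphic_on_line) (simp add: invariants_def)
    then have "f holomorphic_on cball 0 r"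
      unfolding f_def scalar_line_def by (intro holomorphic_intros) simp
    then obtain \<zeta> where \<zeta>: "norm \<zeta> = r" "n * r \<le> norm (f \<zeta> - of_real n * cnj \<zeta>)"
      using cnj_not_approximable_by_holomorphic[OF z(1) n] by blast
    have "pi0 (scalar_line z \<zeta>) \<in> C" using z(2)[of \<zeta>] \<zeta>(1) DC by auto
    from close[OF this] have "norm (q (scalar_line z \<zeta>) - cnj (p (scalar_line z \<zeta>))) \<le> 2 * e"
      by (simp add: pi0_apply p q(1))
    moreover have "q (scalar_line z \<zeta>) - cnj (p (scalar_line z \<zeta>)) = f \<zeta> - of_real n * cnj \<zeta>"
      by (simp add: f_def p_def trace_scalar_line n_def)
    ultimately show False using \<zeta>(2) e by (simp add: e_def)
  qed
  then show ?thesis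
    using section_subalgebra_closure_trace_algebra[OF bdry_ne] T by simp
qed

end
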